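(* Let $M$ be a complete length space with a universal cover $\tilde M$, fundamental group $\pi_1(M)$, and universal slipping group $\pi_{slip}(M)\subset\pi_1(M)$. Then the universal delta cover $\tilde M^0$ satisfies $$\tilde M^0=\tilde M/\pi_{slip}(M)$$ and is thus a regular covering space of $M$.
   Context: A complete length space is a complete metric space in which every pair of points is joined by a length-minimizing rectifiable curve whose length is the distance between the points. A universal cover $\tilde M$ of $M$ is a covering space of $M$ that covers every other covering space of $M$ (it is not assumed simply connected); covering spaces carry the lifted length metric. Each $g\in\pi_1(M)$ is viewed as a deck transformation of $\tilde M$, with length $L(g)=\inf_{\tilde x\in\tilde M}d_{\tilde M}(g\tilde x,\tilde x)$. The universal slipping group $\pi_{slip}(M)$ is the set of all $g\in\pi_1(M)$ such that for every $\delta>0$ there exist $g_1,\dots,g_N\in\pi_1(M)$ (with $N$ depending on $\delta$ and $g$) with $L(g_j)<\delta$ for all $j$ and $g=g_1g_2\cdots g_N$. For $\delta>0$, $\pi_1(M,\delta)$ is the subgroup of $\pi_1(M)$ generated by all $g$ with $L(g)<2\delta$, and the $\delta$ cover is $\tilde M^\delta=\tilde M/\pi_1(M,\delta)$. The universal delta cover $\tilde M^0$ is a covering space of $M$ which covers all the $\delta$ covers $\tilde M^\delta$, $\delta>0$, and such that any other covering space of $M$ which covers all the $\delta$ covers also covers $\tilde M^0$. *)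

theory Defs
  imports "HOL-Analysis.Analysis" "HOL-Algebra.Bij" "HOL-Algebra.Generated_Groups"
begin

section \<open>Length spaces\<close>

definition curve_length :: "'a metric \<Rightarrow> (real \<Rightarrow> 'a) \<Rightarrow> ereal" where
  "curve_length M \<gamma> =
     (SUP (n, t) \<in> {(n::nat, t::nat \<Rightarrow> real). mono_on {..n} t \<and> t ` {..n} \<subseteq> {0..1}}.
        \<Sum>i<n. ereal (mdist M (\<gamma> (t i)) (\<gamma> (t (Suc i)))))"

definition complete_length_space :: "'a metric \<Rightarrow> bool" where
  "complete_length_space M \<longleftrightarrow>
     mcomplete_of M \<and>
     (\<forall>x\<in>mspace M. \<forall>y\<in>mspace M. \<exists>\<gamma>. pathin (mtopology_of M) \<gamma> \<and> \<gamma> 0 = x \<and> \<gamma> 1 = y \<and>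
        curve_length M \<gamma> = ereal (mdist M x y))"


section \<open>Covering spaces\<close>

text \<open>The library predicate \<^const>\<open>covering_space\<close> is tied to the type class topology of its types.
  Here covering spaces are varied over all topologies, so the same condition is stated for
  \<^typ>\<open>'a topology\<close>.\<close>

definition covering_map :: "'b topology \<Rightarrow> ('b \<Rightarrow> 'a) \<Rightarrow> 'a topology \<Rightarrow> bool" where
  "covering_map X p B \<longleftrightarrow>
     continuous_map X B p \<and> p ` topspace X = topspace B \<and>
     (\<forall>b\<in>topspace B. \<exists>U. openin B U \<and> b \<in> U \<and>
        (\<exists>\<V>. \<Union>\<V> = {x \<in> topspace X. p x \<in> U} \<and> (\<forall>V\<in>\<V>. openin X V) \<and> pairwise disjnt \<V> \<and>
             (\<forall>V\<in>\<V>. homeomorphic_map (subtopology X V) (subtopology B U) p)))"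

text \<open>Covering spaces carry the lifted length metric and are length spaces; so they are connected.\<close>

definition covering_space_of :: "'a metric \<Rightarrow> 'b topology \<Rightarrow> ('b \<Rightarrow> 'a) \<Rightarrow> bool" where
  "covering_space_of M X p \<longleftrightarrow> connected_space X \<and> covering_map X p (mtopology_of M)"

definition covers :: "'b topology \<Rightarrow> ('b \<Rightarrow> 'a) \<Rightarrow> 'c topology \<Rightarrow> ('c \<Rightarrow> 'a) \<Rightarrow> bool" where
  "covers X p Y q \<longleftrightarrow> (\<exists>f. covering_map X f Y \<and> (\<forall>x\<in>topspace X. q (f x) = p x))"

definition isomorphic_covers ::
    "'b topology \<Rightarrow> ('b \<Rightarrow> 'a) \<Rightarrow> 'c topology \<Rightarrow> ('c \<Rightarrow> 'a) \<Rightarrow> bool" where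
  "isomorphic_covers X p Y q \<longleftrightarrow>
     (\<exists>f. homeomorphic_map X Y f \<and> (\<forall>x\<in>topspace X. q (f x) = p x))"

definition deck_transformations :: "'b topology \<Rightarrow> ('b \<Rightarrow> 'a) \<Rightarrow> ('b \<Rightarrow> 'b) set" where
  "deck_transformations X p =
     {g \<in> Bij (topspace X). homeomorphic_map X X g \<and> (\<forall>x\<in>topspace X. p (g x) = p x)}"

definition deck_group :: "'b topology \<Rightarrow> ('b \<Rightarrow> 'a) \<Rightarrow> ('b \<Rightarrow> 'b) monoid" where
  "deck_group X p = (BijGroup (topspace X))\<lparr>carrier := deck_transformations X p\<rparr>"

definition regular_covering_space_of :: "'a metric \<Rightarrow> 'b topology \<Rightarrow> ('b \<Rightarrow> 'a) \<Rightarrow> bool" where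
  "regular_covering_space_of M X p \<longleftrightarrow>
     covering_space_of M X p \<and>
     (\<forall>x\<in>topspace X. \<forall>y\<in>topspace X. p x = p y \<longrightarrow> (\<exists>g\<in>deck_transformations X p. g x = y))"

text \<open>A covering space may live on any type, and HOL cannot quantify over types inside a
  definition; so the notions below that refer to every other covering space take as a parameter the
  type \<open>'c\<close> of the points of those covering spaces. For a complete length space
  \<open>M :: 'a metric\<close>, every (connected) covering space is isomorphic to one with points in
  \<open>'a path_set\<close>: a point \<open>y\<close> is determined by the projection to \<open>M\<close> of a path from a base
  point to \<open>y\<close>. Quantifying over this type therefore amounts to quantifying over all
  covering spaces.\<close>

type_synonym 'a path_set = "(real \<Rightarrow> 'a) set"

definition universal_cover :: "'c itself \<Rightarrow> 'a metric \<Rightarrow> 'b topology \<Rightarrow> ('b \<Rightarrow> 'a) \<Rightarrow> bool" where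
  "universal_cover (_::'c itself) M X p \<longleftrightarrow>
     covering_space_of M X p \<and>
     (\<forall>(Y::'c topology) q. covering_space_of M Y q \<longrightarrow> covers X p Y q)"


section \<open>Quotients of a covering space by deck transformations\<close>

definition orbit_of :: "('b \<Rightarrow> 'b) set \<Rightarrow> 'b \<Rightarrow> 'b set" where
  "orbit_of H x = (\<lambda>g. g x) ` H"

definition orbit_space :: "'b topology \<Rightarrow> ('b \<Rightarrow> 'b) set \<Rightarrow> 'b set topology" where
  "orbit_space X H =
     topology (\<lambda>V. V \<subseteq> orbit_of H ` topspace X \<and> openin X {x \<in> topspace X. orbit_of H x \<in> V})"

lemma openin_orbit_space:
  "openin (orbit_space X H) V \<longleftrightarrow>
     V \<subseteq> orbit_of H ` topspace X \<and> openin X {x \<in> topspace X. orbit_of H x \<in> V}"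
proof -
  have "istopology (\<lambda>V. V \<subseteq> orbit_of H ` topspace X \<and>
                         openin X {x \<in> topspace X. orbit_of H x \<in> V})"
    unfolding istopology_def
  proof (intro conjI allI impI)
    fix S T
    assume "S \<subseteq> orbit_of H ` topspace X \<and> openin X {x \<in> topspace X. orbit_of H x \<in> S}"
      and "T \<subseteq> orbit_of H ` topspace X \<and> openin X {x \<in> topspace X. orbit_of H x \<in> T}"
    moreover have "{x \<in> topspace X. orbit_of H x \<in> S \<inter> T} =
        {x \<in> topspace X. orbit_of H x \<in> S} \<inter> {x \<in> topspace X. orbit_of H x \<in> T}"
      by auto
    ultimately show "S \<inter> T \<subseteq> orbit_of H ` topspace X"
      and "openin X {x \<in> topspace X. orbit_of H x \<in> S \<inter> T}"
      by auto
  next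
    fix \<K>
    assume *: "\<forall>K\<in>\<K>. K \<subseteq> orbit_of H ` topspace X \<and> openin X {x \<in> topspace X. orbit_of H x \<in> K}"
    then show "\<Union>\<K> \<subseteq> orbit_of H ` topspace X"
      by blast
    have "{x \<in> topspace X. orbit_of H x \<in> \<Union>\<K>} = (\<Union>K\<in>\<K>. {x \<in> topspace X. orbit_of H x \<in> K})"
      by auto
    with * show "openin X {x \<in> topspace X. orbit_of H x \<in> \<Union>\<K>}"
      by auto
  qed
  then show ?thesis
    by (simp add: orbit_space_def)
qed

text \<open>The projection induced by \<open>p\<close>, which is constant on the orbits of deck transformations.\<close>

definition orbit_proj :: "('b \<Rightarrow> 'a) \<Rightarrow> 'b set \<Rightarrow> 'a" where
  "orbit_proj p C = the_elem (p ` C)"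


section \<open>The slipping group, delta covers and the universal delta cover\<close>

text \<open>In this section \<open>X\<close>, with projection \<open>p\<close>, is a universal cover of \<open>M\<close>. The elements of
  the fundamental group are taken as deck transformations of \<open>X\<close>, so the fundamental group appears
  as \<^term>\<open>deck_group X p\<close>. As \<open>X\<close> need not be simply connected, this is the quotient of the
  group of homotopy classes of loops by the classes that act trivially on \<open>X\<close>.\<close>

definition lifted_dist :: "'a metric \<Rightarrow> 'b topology \<Rightarrow> ('b \<Rightarrow> 'a) \<Rightarrow> 'b \<Rightarrow> 'b \<Rightarrow> ereal" where
  "lifted_dist M X p x y =
     (INF \<gamma> \<in> {\<gamma>. pathin X \<gamma> \<and> \<gamma> 0 = x \<and> \<gamma> 1 = y}. curve_length M (p \<circ> \<gamma>))"

definition deck_length :: "'a metric \<Rightarrow> 'b topology \<Rightarrow> ('b \<Rightarrow> 'a) \<Rightarrow> ('b \<Rightarrow> 'b) \<Rightarrow> ereal" where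
  "deck_length M X p g = (INF x \<in> topspace X. lifted_dist M X p (g x) x)"

definition slipping_group :: "'a metric \<Rightarrow> 'b topology \<Rightarrow> ('b \<Rightarrow> 'a) \<Rightarrow> ('b \<Rightarrow> 'b) set" where
  "slipping_group M X p =
     {g \<in> carrier (deck_group X p). \<forall>\<delta>>0. \<exists>gs.
        set gs \<subseteq> carrier (deck_group X p) \<and>
        (\<forall>h\<in>set gs. deck_length M X p h < ereal \<delta>) \<and>
        g = foldr (\<otimes>\<^bsub>deck_group X p\<^esub>) gs \<one>\<^bsub>deck_group X p\<^esub>}"

definition delta_group :: "'a metric \<Rightarrow> 'b topology \<Rightarrow> ('b \<Rightarrow> 'a) \<Rightarrow> real \<Rightarrow> ('b \<Rightarrow> 'b) set" where
  "delta_group M X p \<delta> =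
     generate (deck_group X p)
       {g \<in> carrier (deck_group X p). deck_length M X p g < ereal (2 * \<delta>)}"

abbreviation delta_cover :: "'a metric \<Rightarrow> 'b topology \<Rightarrow> ('b \<Rightarrow> 'a) \<Rightarrow> real \<Rightarrow> 'b set topology" where
  "delta_cover M X p \<delta> \<equiv> orbit_space X (delta_group M X p \<delta>)"

definition covers_delta_covers ::
    "'a metric \<Rightarrow> 'b topology \<Rightarrow> ('b \<Rightarrow> 'a) \<Rightarrow> 'c topology \<Rightarrow> ('c \<Rightarrow> 'a) \<Rightarrow> bool" where
  "covers_delta_covers M X p Y q \<longleftrightarrow> (\<forall>\<delta>>0. covers Y q (delta_cover M X p \<delta>) (orbit_proj p))"

text \<open>As for \<^const>\<open>universal_cover\<close>, the first argument gives the type of the points of the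
  competing covering spaces.\<close>

definition universal_delta_cover ::
    "'c itself \<Rightarrow> 'a metric \<Rightarrow> 'b topology \<Rightarrow> ('b \<Rightarrow> 'a) \<Rightarrow> 'd topology \<Rightarrow> ('d \<Rightarrow> 'a) \<Rightarrow> bool" where
  "universal_delta_cover (_::'c itself) M X p Z r \<longleftrightarrow>
     covering_space_of M Z r \<and>
     covers_delta_covers M X p Z r \<and>
     (\<forall>(Y::'c topology) q.
        covering_space_of M Y q \<and> covers_delta_covers M X p Y q \<longrightarrow> covers Y q Z r)"

end

theory Submission
  imports Defs
begin

text \<open>Write \<open>B\<close> for the topology of \<open>M\<close>, \<open>G\<close> for the group of deck transformations of the universal
  cover \<open>X\<close>, \<open>K \<delta>\<close> for the delta groups and \<open>S\<close> for the slipping group.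

  The algebra is short. The length of a deck transformation does not increase under conjugation or
  inversion, because deck transformations and path reversal preserve the lengths of projected
  paths. So the generating set of \<open>K \<delta>\<close> is closed under inverses and conjugates: \<open>K \<delta>\<close> is normal, and
  its elements are exactly the products of deck transformations of length below \<open>2 * \<delta>\<close>. Hence \<open>S\<close>
  is the intersection of all \<open>K \<delta>\<close>, a normal subgroup (\<open>slipping_group_eq_Inter\<close>,
  \<open>normal_slipping_group\<close>).

  The topology needs that \<open>G\<close> acts transitively on the fibres of \<open>X\<close>, although \<open>X\<close> is only assumed to
  cover every other covering space (\<open>universal_cover_regular\<close>). To see this, form the
  covering space \<open>W\<close> of \<open>M\<close> whose points over \<open>b\<close> are the surjections \<open>\<phi>\<close> from the type of points of
  \<open>X\<close> onto the fibre of \<open>X\<close> over \<open>b\<close>, two surjections being on one sheet if their values are. The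
  space \<open>X\<close> covers a component of \<open>W\<close>, by \<open>f\<close> say. For each \<open>z\<close>, the map taking \<open>x\<close> to \<open>f x z\<close> is a
  morphism from \<open>X\<close> to itself over \<open>M\<close>; and as \<open>f x\<close> is onto, every point in the fibre of \<open>x\<close> is the
  image of \<open>x\<close> under one of them. Such morphisms are invertible by unique lifting.

  Now \<open>X / S\<close> is a regular covering space of \<open>M\<close>, because \<open>S\<close> is normal, and it covers each \<open>X / K \<delta>\<close>
  because \<open>S\<close> is contained in \<open>K \<delta>\<close>. Conversely let \<open>Y\<close> cover every \<open>X / K \<delta>\<close>, and let \<open>f\<close> be a
  covering from \<open>X\<close> to \<open>Y\<close>. If \<open>f x = f x'\<close>, then \<open>x' = g x\<close> with \<open>g\<close> in \<open>G\<close>. The composite of \<open>f\<close> with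
  the map to \<open>X / K \<delta>\<close> is the quotient map preceded by a deck transformation, so some conjugate of
  \<open>g\<close> lies in \<open>K \<delta>\<close>, hence so does \<open>g\<close>. This holds for all \<open>\<delta>\<close>, so \<open>g\<close> is in \<open>S\<close>: the quotient
  map to \<open>X / S\<close> factors through \<open>f\<close> (\<open>covers_slipping_quotient\<close>). Finally another universal delta
  cover and \<open>X / S\<close> cover each other, and as \<open>X / S\<close> is regular they are homeomorphic over \<open>M\<close>
  (\<open>mutual_covers_imp_homeomorphic\<close>).

  The universal properties in the hypotheses only speak of covering spaces with points in a fixed
  type. They reach all covering spaces because each one is homeomorphic to one with points in that
  type (\<open>covering_space_copy_path_set\<close>).\<close>

section \<open>Coverings by local sections\<close>

text \<open>A set \<open>U\<close> is evenly covered if and only if through each point \<open>x\<close> over \<open>U\<close> there is a continuous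
  section \<open>s x\<close> on \<open>U\<close> with open image, such that \<open>s y = s x\<close> on \<open>U\<close> for all \<open>y\<close> in that image; the
  sheets are the images. Sections rather than sheets make it possible to write down a
  covering by one formula for \<open>s\<close>, and to compare two coverings pointwise.\<close>

definition sections_over ::
    "'b topology \<Rightarrow> ('b \<Rightarrow> 'a) \<Rightarrow> 'a topology \<Rightarrow> 'a set \<Rightarrow> ('b \<Rightarrow> 'a \<Rightarrow> 'b) \<Rightarrow> bool" where
  "sections_over X p B U s \<longleftrightarrow> openin B U \<and>
     (\<forall>x\<in>topspace X. p x \<in> U \<longrightarrow>
        continuous_map (subtopology B U) X (s x) \<and> (\<forall>u\<in>U. p (s x u) = u) \<and>
        s x (p x) = x \<and> openin X (s x ` U) \<and> (\<forall>u\<in>U. \<forall>v\<in>U. s (s x u) v = s x v))"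

lemma sections_overD:
  assumes "sections_over X p B U s" "x \<in> topspace X" "p x \<in> U"
  shows "continuous_map (subtopology B U) X (s x)" "\<And>u. u \<in> U \<Longrightarrow> p (s x u) = u" "s x (p x) = x"
    "openin X (s x ` U)" "\<And>u v. u \<in> U \<Longrightarrow> v \<in> U \<Longrightarrow> s (s x u) v = s x v"
    "\<And>u. u \<in> U \<Longrightarrow> s x u \<in> topspace X"
proof -
  have *: "continuous_map (subtopology B U) X (s x) \<and> (\<forall>u\<in>U. p (s x u) = u) \<and>
        s x (p x) = x \<and> openin X (s x ` U) \<and> (\<forall>u\<in>U. \<forall>v\<in>U. s (s x u) v = s x v)"
    using assms by (simp add: sections_over_def)
  from * show "continuous_map (subtopology B U) X (s x)" "s x (p x) = x" "openin X (s x ` U)"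
    by simp_all
  from * show "p (s x u) = u" if "u \<in> U" for u using that by simp
  from * show "s (s x u) v = s x v" if "u \<in> U" "v \<in> U" for u v using that by simp
  from * show "s x u \<in> topspace X" if "u \<in> U" for u using that openin_subset by blast
qed

lemma sections_over_openin: "sections_over X p B U s \<Longrightarrow> openin B U"
  by (simp add: sections_over_def)

lemma sections_over_subset:
  assumes s: "sections_over X p B U s" and p: "continuous_map X B p"
    and U': "openin B U'" "U' \<subseteq> U"
  shows "sections_over X p B U' s"
  unfolding sections_over_def
proof (intro conjI ballI impI U')
  fix x assume x: "x \<in> topspace X" "p x \<in> U'"
  then have xU: "p x \<in> U" using U' by auto
  note D = sections_overD[OF s x(1) xU]
  show "continuous_map (subtopology B U') X (s x)"
    by (rule continuous_map_from_subtopology_mono[OF D(1) U'(2)])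
  show "p (s x u) = u" if "u \<in> U'" for u using D(2) that U' by auto
  show "s x (p x) = x" by (rule D(3))
  show "s (s x u) v = s x v" if "u \<in> U'" "v \<in> U'" for u v using D(5) that U' by auto
  have "s x ` U' = s x ` U \<inter> {y \<in> topspace X. p y \<in> U'}"
    using D(2,6) U'(2) by force
  then show "openin X (s x ` U')"
    using D(4) openin_continuous_map_preimage[OF p U'(1)] by auto
qed

text \<open>From sheets to sections: invert the projection on the sheet containing \<open>x\<close>. From sections to
  sheets: two images that meet coincide, by the last clause of \<^const>\<open>sections_over\<close>.\<close>

lemma covering_map_iff_sections_over:
  "covering_map X p B \<longleftrightarrow> continuous_map X B p \<and> p ` topspace X = topspace B \<and>
     (\<forall>b\<in>topspace B. \<exists>U s. b \<in> U \<and> sections_over X p B U s)"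
proof -
  have "(\<exists>\<V>. \<Union>\<V> = {x \<in> topspace X. p x \<in> U} \<and> (\<forall>V\<in>\<V>. openin X V) \<and> pairwise disjnt \<V> \<and>
             (\<forall>V\<in>\<V>. homeomorphic_map (subtopology X V) (subtopology B U) p)) \<longleftrightarrow>
        (\<exists>s. sections_over X p B U s)" (is "?L \<longleftrightarrow> ?R")
    if p: "continuous_map X B p" and U: "openin B U" for U
  proof
    assume ?L
    then obtain \<V> where \<V>: "\<Union>\<V> = {x \<in> topspace X. p x \<in> U}" "\<And>V. V \<in> \<V> \<Longrightarrow> openin X V"
      and disj: "pairwise disjnt \<V>"
      and hom: "\<And>V. V \<in> \<V> \<Longrightarrow> homeomorphic_map (subtopology X V) (subtopology B U) p" by metis
    have UB: "topspace (subtopology B U) = U" using openin_subset[OF U] by auto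
    have VX: "topspace (subtopology X V) = V" if "V \<in> \<V>" for V
      using openin_subset[OF \<V>(2)[OF that]] by auto
    have "\<exists>g. homeomorphic_maps (subtopology X V) (subtopology B U) p g" if "V \<in> \<V>" for V
      using hom[OF that] homeomorphic_map_maps by blast
    then obtain g where g: "\<And>V. V \<in> \<V> \<Longrightarrow> homeomorphic_maps (subtopology X V) (subtopology B U) p (g V)"
      by metis
    have "\<exists>V. V \<in> \<V> \<and> x \<in> V" if "x \<in> topspace X" "p x \<in> U" for x
      using that \<V>(1) by blast
    then obtain W where W: "\<And>x. x \<in> topspace X \<Longrightarrow> p x \<in> U \<Longrightarrow> W x \<in> \<V> \<and> x \<in> W x"
      by metis
    have Weq: "W x = V" if "x \<in> V" "V \<in> \<V>" for x V
    proof -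
      have "x \<in> topspace X" "p x \<in> U" using that \<V>(1) by blast+
      then have "W x \<in> \<V>" "x \<in> W x" using W by auto
      then show ?thesis using disj that unfolding pairwise_def disjnt_def by blast
    qed
    have "sections_over X p B U (\<lambda>x. g (W x))"
      unfolding sections_over_def
    proof (intro conjI ballI impI U)
      fix x assume x: "x \<in> topspace X" "p x \<in> U"
      then have WV: "W x \<in> \<V>" and xW: "x \<in> W x" using W by auto
      note G = g[OF WV, unfolded homeomorphic_maps_def UB VX[OF WV]]
      show "continuous_map (subtopology B U) X (g (W x))"
        using G continuous_map_in_subtopology by blast
      have gW: "g (W x) u \<in> W x" if "u \<in> U" for u
        using G that continuous_map_funspace[of "subtopology B U" "subtopology X (W x)"]
        unfolding UB VX[OF WV] by (auto simp: Pi_iff)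
      show "p (g (W x) u) = u" if "u \<in> U" for u using G that by blast
      show "g (W x) (p x) = x" using G xW by blast
      have "p y \<in> U" if "y \<in> W x" for y using \<V>(1) WV that by blast
      then have "g (W x) ` U = W x" using gW G by force
      then show "openin X (g (W x) ` U)" using \<V>(2)[OF WV] by simp
      show "g (W (g (W x) u)) v = g (W x) v" if "u \<in> U" "v \<in> U" for u v
        using Weq[OF gW[OF that(1)] WV] by simp
    qed
    then show ?R by blast
  next
    assume ?R
    then obtain s where s: "sections_over X p B U s" by blast
    define \<V> where "\<V> = (\<lambda>x. s x ` U) ` {x \<in> topspace X. p x \<in> U}"
    show ?L
    proof (intro exI[of _ \<V>] conjI ballI)
      show "\<Union>\<V> = {x \<in> topspace X. p x \<in> U}"
      proof
        show "\<Union>\<V> \<subseteq> {x \<in> topspace X. p x \<in> U}"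
          unfolding \<V>_def using sections_overD(2,6)[OF s] by auto
        show "{x \<in> topspace X. p x \<in> U} \<subseteq> \<Union>\<V>"
        proof clarify
          fix x assume "x \<in> topspace X" "p x \<in> U"
          then show "x \<in> \<Union>\<V>"
            unfolding \<V>_def using sections_overD(3)[OF s] by (metis (mono_tags, lifting) UN_iff image_eqI mem_Collect_eq)
        qed
      qed
      show "openin X V" if "V \<in> \<V>" for V
        using that sections_overD(4)[OF s] unfolding \<V>_def by blast
      show "pairwise disjnt \<V>"
      proof (clarsimp simp: pairwise_def \<V>_def disjnt_iff)
        fix x y z w assume *: "x \<in> topspace X" "p x \<in> U" "y \<in> topspace X" "p y \<in> U"
          "s x ` U \<noteq> s y ` U" "s x z = s y w" "z \<in> U" "w \<in> U"
        have "s x v = s y v" if "v \<in> U" for v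
          using sections_overD(5)[OF s] that * by metis
        then show False using * by (metis image_cong)
      qed
      fix V assume "V \<in> \<V>"
      then obtain x where x: "x \<in> topspace X" "p x \<in> U" "V = s x ` U" unfolding \<V>_def by blast
      note D = sections_overD[OF s x(1,2)]
      have "homeomorphic_maps (subtopology X V) (subtopology B U) p (s x)"
        unfolding homeomorphic_maps_def
        using p D x by (auto simp: continuous_map_in_subtopology continuous_map_from_subtopology)
      then show "homeomorphic_map (subtopology X V) (subtopology B U) p"
        using homeomorphic_map_maps by blast
    qed
  qed
  then show ?thesis
    unfolding covering_map_def using sections_over_openin by (smt (verit, best))
qed

lemma covering_mapD:
  assumes "covering_map X p B"
  shows "continuous_map X B p" "p ` topspace X = topspace B"
    "\<And>x. x \<in> topspace X \<Longrightarrow> p x \<in> topspace B"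
  using assms unfolding covering_map_def by auto

lemma covering_map_sectionsE:
  assumes "covering_map X p B" "b \<in> topspace B"
  obtains U s where "b \<in> U" "sections_over X p B U s"
  using assms unfolding covering_map_iff_sections_over by (metis (no_types))

lemma sections_over_path_connected:
  assumes "covering_map X p B" "locally_path_connected_space B" "openin B N" "b \<in> N"
  obtains U s where "b \<in> U" "U \<subseteq> N" "path_connectedin B U" "sections_over X p B U s"
proof -
  have "b \<in> topspace B" using assms(3,4) openin_subset by blast
  then obtain U s where U: "b \<in> U" "sections_over X p B U s"
    using assms(1) covering_map_iff_sections_over by metis
  have "openin B (U \<inter> N)" "b \<in> U \<inter> N" using U assms sections_over_openin by blast+
  then obtain U' where "openin B U'" "path_connectedin B U'" "b \<in> U'" "U' \<subseteq> U \<inter> N"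
    using assms(2) unfolding locally_path_connected_space by metis
  then show ?thesis
    using that sections_over_subset[OF U(2) covering_mapD(1)[OF assms(1)]] by blast
qed

text \<open>Both the set of agreement and its complement are open: near a point of agreement the two maps
  run in the same sheet, and near a point of disagreement in two different, hence disjoint, sheets
  over the same set.\<close>

lemma unique_lifting:
  assumes p: "covering_map X p B" and C: "connected_space C"
    and g: "continuous_map C X g" and h: "continuous_map C X h"
    and eq: "\<And>c. c \<in> topspace C \<Longrightarrow> p (g c) = p (h c)"
    and c0: "c0 \<in> topspace C" "g c0 = h c0" and c: "c \<in> topspace C"
  shows "g c = h c"
proof -
  define E where "E = {c \<in> topspace C. g c = h c}"
  have gX: "g c \<in> topspace X" and hX: "h c \<in> topspace X" if "c \<in> topspace C" for c
    using g h that by (auto simp: continuous_map_def Pi_iff)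
  have sec: "\<exists>U s. p (g c) \<in> U \<and> sections_over X p B U s" if "c \<in> topspace C" for c
    using p covering_mapD(3)[OF p gX[OF that]] covering_map_iff_sections_over by metis
  have "openin C E"
  proof (subst openin_subopen, intro ballI)
    fix c assume "c \<in> E"
    then have c: "c \<in> topspace C" "g c = h c" by (auto simp: E_def)
    obtain U s where U: "p (g c) \<in> U" and s: "sections_over X p B U s" using sec[OF c(1)] by blast
    note D = sections_overD[OF s gX[OF c(1)] U]
    define N where "N = {c' \<in> topspace C. g c' \<in> s (g c) ` U} \<inter> {c' \<in> topspace C. h c' \<in> s (g c) ` U}"
    have "openin C N"
      unfolding N_def using openin_continuous_map_preimage[OF g D(4)] openin_continuous_map_preimage[OF h D(4)] by auto
    moreover have "c \<in> N"
      unfolding N_def using c D(3) U by force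
    moreover have "N \<subseteq> E"
      unfolding N_def E_def using eq D(2) by (auto, metis)
    ultimately show "\<exists>T. openin C T \<and> c \<in> T \<and> T \<subseteq> E" by blast
  qed
  moreover have "openin C (topspace C - E)"
  proof (subst openin_subopen, intro ballI)
    fix c assume "c \<in> topspace C - E"
    then have c: "c \<in> topspace C" "g c \<noteq> h c" by (auto simp: E_def)
    obtain U s where U: "p (g c) \<in> U" and s: "sections_over X p B U s" using sec[OF c(1)] by blast
    have U': "p (h c) \<in> U" using U eq[OF c(1)] by simp
    note D = sections_overD[OF s gX[OF c(1)] U]
    note D' = sections_overD[OF s hX[OF c(1)] U']
    define N where "N = {c' \<in> topspace C. g c' \<in> s (g c) ` U} \<inter> {c' \<in> topspace C. h c' \<in> s (h c) ` U}"
    have "openin C N"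
      unfolding N_def using openin_continuous_map_preimage[OF g D(4)] openin_continuous_map_preimage[OF h D'(4)] by auto
    moreover have "c \<in> N"
      unfolding N_def using c D(3) D'(3) U U' by (auto intro: image_eqI[OF sym])
    moreover have "N \<subseteq> topspace C - E"
    proof
      fix c' assume "c' \<in> N"
      then obtain u v where uv: "c' \<in> topspace C" "u \<in> U" "v \<in> U" "g c' = s (g c) u" "h c' = s (h c) v"
        unfolding N_def by auto
      have "g c' \<noteq> h c'"
      proof
        assume "g c' = h c'"
        then have "s (g c) (p (g c)) = s (h c) (p (g c))"
          using uv D(5)[OF _ U] D'(5)[OF _ U] by metis
        then show False using c D(3) D'(3) eq[OF c(1)] by simp
      qed
      then show "c' \<in> topspace C - E" using uv E_def by blast
    qed
    ultimately show "\<exists>T. openin C T \<and> c \<in> T \<and> T \<subseteq> topspace C - E" by blast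
  qed
  ultimately have "E = topspace C"
    using C c0 unfolding connected_space_clopen_in closedin_def E_def by blast
  then show ?thesis using c E_def by blast
qed

text \<open>Both sides are lifts of the inclusion of the connected set \<open>U\<close> that agree at \<open>p x\<close>. So morphisms
  over the base map sheets to sheets without any choice.\<close>

lemma morphism_sections:
  assumes q: "covering_map Y q B" and f: "continuous_map X Y f" "\<And>x. x \<in> topspace X \<Longrightarrow> q (f x) = p x"
    and U: "connectedin B U" "sections_over X p B U s" "sections_over Y q B U t"
    and x: "x \<in> topspace X" "p x \<in> U" and u: "u \<in> U"
  shows "f (s x u) = t (f x) u"
proof -
  have fx: "f x \<in> topspace Y" "q (f x) \<in> U"
    using f x by (auto simp: continuous_map_def Pi_iff)
  note D = sections_overD[OF U(2) x] and E = sections_overD[OF U(3) fx]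
  have top: "topspace (subtopology B U) = U" using connectedin_subset_topspace[OF U(1)] by auto
  have "(f \<circ> s x) u = t (f x) u"
  proof (rule unique_lifting[OF q, of "subtopology B U" _ _ "p x"])
    show "connected_space (subtopology B U)" using U(1) connectedin_def by blast
    show "continuous_map (subtopology B U) Y (f \<circ> s x)" using D(1) f(1) continuous_map_compose by blast
    show "continuous_map (subtopology B U) Y (t (f x))" by (rule E(1))
  qed (use D E fx x u f(2) top in auto)
  then show ?thesis by simp
qed

text \<open>The tool by which all coverings between covering spaces are obtained: over a small connected
  set \<open>U\<close>, the sheet of \<open>Y\<close> through \<open>y\<close> is evenly covered by \<open>f\<close>, with sections those of \<open>X\<close> over \<open>U\<close>
  composed with \<open>q\<close>.\<close>

lemma covering_map_over:
  assumes B: "locally_path_connected_space B"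
    and p: "covering_map X p B" and q: "covering_map Y q B"
    and f: "continuous_map X Y f" "f ` topspace X = topspace Y" "\<And>x. x \<in> topspace X \<Longrightarrow> q (f x) = p x"
  shows "covering_map X f Y"
  unfolding covering_map_iff_sections_over
proof (intro conjI ballI f)
  fix y assume y: "y \<in> topspace Y"
  have qy: "q y \<in> topspace B" using covering_mapD(3)[OF q y] .
  obtain U0 s where U0: "q y \<in> U0" and s0: "sections_over X p B U0 s"
    using p qy covering_map_iff_sections_over by metis
  obtain U t where U: "q y \<in> U" "U \<subseteq> U0" "path_connectedin B U" and t: "sections_over Y q B U t"
    using sections_over_path_connected[OF q B sections_over_openin[OF s0] U0] by blast
  have s: "sections_over X p B U s"
    using sections_over_subset[OF s0 covering_mapD(1)[OF p] sections_over_openin[OF t] U(2)] .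
  have conn: "connectedin B U" using U(3) path_connectedin_imp_connectedin by blast
  note E = sections_overD[OF t y U(1)]
  have fX: "f x \<in> topspace Y" if "x \<in> topspace X" for x using f(2) that by blast
  have qV: "q ` (t y ` U) = U" using E(2) by force
  have contq: "continuous_map (subtopology Y (t y ` U)) (subtopology B U) q"
    using covering_mapD(1)[OF q] qV by (auto simp: continuous_map_in_subtopology continuous_map_from_subtopology)
  have "sections_over X f Y (t y ` U) (\<lambda>x v. s x (q v))"
    unfolding sections_over_def
  proof (intro conjI ballI impI E)
    fix x assume x: "x \<in> topspace X" "f x \<in> t y ` U"
    then have pxU: "p x \<in> U" using f(3)[OF x(1)] E(2) by auto
    note D = sections_overD[OF s x(1) pxU]
    show "continuous_map (subtopology Y (t y ` U)) X (\<lambda>v. s x (q v))"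
      using continuous_map_compose[OF contq D(1)] by (simp add: o_def)
    show "s x (q (f x)) = x" using D(3) f(3) x by simp
    show "openin X ((\<lambda>v. s x (q v)) ` t y ` U)"
      using D(4) qV by (metis image_image)
    show "f (s x (q v)) = v" if "v \<in> t y ` U" for v
    proof -
      have "f (s x (q v)) = t (f x) (q v)"
        using morphism_sections[OF q f(1,3) conn s t x(1) pxU, of "q v"] qV that by blast
      also have "\<dots> = t y (q v)"
      proof -
        obtain u where "u \<in> U" "f x = t y u" using x(2) by auto
        moreover have "q v \<in> U" using qV that by blast
        ultimately show ?thesis using E(5) by simp
      qed
      also have "\<dots> = v" using that E(2) by auto
      finally show ?thesis .
    qed
    show "s (s x (q u)) (q v) = s x (q v)" if "u \<in> t y ` U" "v \<in> t y ` U" for u v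
      using D(5) that qV by blast
  qed
  moreover have "y \<in> t y ` U"
    using E(3) U(1) by force
  ultimately show "\<exists>V r. y \<in> V \<and> sections_over X f Y V r"
    by (intro exI[of _ "t y ` U"] exI[of _ "\<lambda>x v. s x (q v)"] conjI)
qed

section \<open>Deck transformations and orbit spaces\<close>

lemma deck_transformationsD:
  assumes "g \<in> deck_transformations X p"
  shows "g \<in> Bij (topspace X)" "continuous_map X X g" "homeomorphic_map X X g"
    "\<And>x. x \<in> topspace X \<Longrightarrow> p (g x) = p x" "\<And>x. x \<in> topspace X \<Longrightarrow> g x \<in> topspace X"
  using assms homeomorphic_imp_continuous_map[of X X g]
  by (auto simp: deck_transformations_def Bij_def bij_betw_def)

lemma deck_transformationsI:
  assumes "homeomorphic_maps X X g h" "\<And>x. x \<in> topspace X \<Longrightarrow> p (g x) = p x"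
  shows "restrict g (topspace X) \<in> deck_transformations X p"
proof -
  have hom: "homeomorphic_map X X g" using assms(1) homeomorphic_map_maps by blast
  then have "bij_betw g (topspace X) (topspace X)"
    by (simp add: bij_betw_def homeomorphic_imp_injective_map homeomorphic_imp_surjective_map)
  then have "restrict g (topspace X) \<in> Bij (topspace X)" by (simp add: Bij_def)
  moreover have "homeomorphic_map X X (restrict g (topspace X))"
    using hom homeomorphic_map_eq[of X X g "restrict g (topspace X)"] by simp
  ultimately show ?thesis using assms(2) by (simp add: deck_transformations_def)
qed

lemma carrier_deck_group: "carrier (deck_group X p) = deck_transformations X p"
  by (simp add: deck_group_def)

lemma deck_group_one: "\<one>\<^bsub>deck_group X p\<^esub> = restrict (\<lambda>x. x) (topspace X)"
  by (simp add: deck_group_def BijGroup_def)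

lemma deck_group_mult:
  assumes "g \<in> deck_transformations X p" "h \<in> deck_transformations X p"
  shows "g \<otimes>\<^bsub>deck_group X p\<^esub> h = compose (topspace X) g h"
  using deck_transformationsD(1)[OF assms(1)] deck_transformationsD(1)[OF assms(2)]
  by (simp add: deck_group_def BijGroup_def)

lemma group_deck_group: "group (deck_group X p)"
proof -
  let ?S = "topspace X"
  have "subgroup (deck_transformations X p) (BijGroup ?S)"
  proof (rule group.subgroupI[OF group_BijGroup])
    show "deck_transformations X p \<subseteq> carrier (BijGroup ?S)"
      by (auto simp: deck_transformations_def BijGroup_def)
    have "restrict (\<lambda>x. x) ?S \<in> deck_transformations X p"
      by (rule deck_transformationsI[where h = "\<lambda>x. x"]) (auto simp: homeomorphic_maps_def)
    then show "deck_transformations X p \<noteq> {}" by blast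
  next
    fix g assume g: "g \<in> deck_transformations X p"
    note D = deck_transformationsD[OF g]
    obtain h where h: "homeomorphic_maps X X g h" using D(3) homeomorphic_map_maps by blast
    then have hS: "h x \<in> ?S" "g (h x) = x" "h (g x) = x" if "x \<in> ?S" for x
      using that by (auto simp: homeomorphic_maps_def continuous_map_def Pi_iff)
    have "restrict (inv_into ?S g) ?S = restrict h ?S"
      using D(1) hS by (auto simp: restrict_def Bij_def bij_betw_def fun_eq_iff intro: inv_into_f_eq)
    moreover have "restrict h ?S \<in> deck_transformations X p"
      by (rule deck_transformationsI[where h = g]) (use h hS D(4) homeomorphic_maps_sym in \<open>blast, metis\<close>)
    ultimately show "inv\<^bsub>BijGroup ?S\<^esub> g \<in> deck_transformations X p"
      using D(1) by (simp add: inv_BijGroup)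
  next
    fix g h assume g: "g \<in> deck_transformations X p" and h: "h \<in> deck_transformations X p"
    note D = deck_transformationsD[OF g] and E = deck_transformationsD[OF h]
    have "homeomorphic_map X X (g \<circ> h)" using D(3) E(3) homeomorphic_map_compose by blast
    then have "homeomorphic_map X X (compose ?S g h)"
      by (rule homeomorphic_map_eq) (auto simp: compose_def)
    then have "compose ?S g h \<in> deck_transformations X p"
      using D(1,4) E(1,4,5) compose_Bij[of g ?S h] by (simp add: deck_transformations_def compose_def)
    then show "g \<otimes>\<^bsub>BijGroup ?S\<^esub> h \<in> deck_transformations X p"
      using D(1) E(1) by (simp add: BijGroup_def)
  qed
  then show ?thesis
    using subgroup.subgroup_is_group[OF _ group_BijGroup] by (auto simp: deck_group_def)
qed

lemma deck_group_mult_apply: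
  assumes "g \<in> deck_transformations X p" "h \<in> deck_transformations X p" "x \<in> topspace X"
  shows "(g \<otimes>\<^bsub>deck_group X p\<^esub> h) x = g (h x)"
  using assms by (simp add: deck_group_mult compose_def)

lemma deck_group_inv_apply:
  assumes g: "g \<in> deck_transformations X p" and x: "x \<in> topspace X"
  shows "inv\<^bsub>deck_group X p\<^esub> g \<in> deck_transformations X p"
    "g ((inv\<^bsub>deck_group X p\<^esub> g) x) = x" "(inv\<^bsub>deck_group X p\<^esub> g) (g x) = x"
proof -
  interpret group "deck_group X p" by (rule group_deck_group)
  show i: "inv\<^bsub>deck_group X p\<^esub> g \<in> deck_transformations X p" using g inv_closed by (simp add: carrier_deck_group)
  show "g ((inv\<^bsub>deck_group X p\<^esub> g) x) = x"
    using r_inv[of g, unfolded deck_group_one carrier_deck_group] g x deck_group_mult_apply[OF g i x] by simp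
  show "(inv\<^bsub>deck_group X p\<^esub> g) (g x) = x"
    using l_inv[of g, unfolded deck_group_one carrier_deck_group] g x deck_group_mult_apply[OF i g x] by simp
qed

locale deck_subgroup =
  fixes X :: "'b topology" and p :: "'b \<Rightarrow> 'a" and H
  assumes H: "subgroup H (deck_group X p)"
begin

lemma deck: "h \<in> H \<Longrightarrow> h \<in> deck_transformations X p"
  using subgroup.subset[OF H] by (auto simp: carrier_deck_group)

lemma orbit_of_refl: "x \<in> topspace X \<Longrightarrow> x \<in> orbit_of H x"
  using image_eqI[of x "\<lambda>g. g x", OF _ subgroup.one_closed[OF H]] by (simp add: orbit_of_def deck_group_one)

lemma orbit_of_act:
  assumes x: "x \<in> topspace X" and h: "h \<in> H"
  shows "orbit_of H (h x) = orbit_of H x"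
proof -
  note mult = deck_group_mult_apply[OF deck deck]
  show ?thesis
  proof
    show "orbit_of H (h x) \<subseteq> orbit_of H x"
      unfolding orbit_of_def
    proof clarify
      fix k assume k: "k \<in> H"
      show "k (h x) \<in> (\<lambda>g. g x) ` H"
        using mult[OF k h x] subgroup.m_closed[OF H k h] by (metis image_eqI)
    qed
    show "orbit_of H x \<subseteq> orbit_of H (h x)"
    proof
      fix y assume "y \<in> orbit_of H x"
      then obtain k where k: "k \<in> H" "y = k x" unfolding orbit_of_def by blast
      let ?i = "inv\<^bsub>deck_group X p\<^esub> h"
      have i: "?i \<in> H" using subgroup.m_inv_closed[OF H h] .
      have hx: "h x \<in> topspace X" using deck_transformationsD(5)[OF deck[OF h] x] .
      have "(k \<otimes>\<^bsub>deck_group X p\<^esub> ?i) (h x) = y"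
        using mult[OF k(1) i hx] deck_group_inv_apply(3)[OF deck[OF h] x] k(2) by simp
      then show "y \<in> orbit_of H (h x)"
        unfolding orbit_of_def using subgroup.m_closed[OF H k(1) i] by blast
    qed
  qed
qed

lemma orbit_of_eq_iff:
  assumes "x \<in> topspace X" "y \<in> topspace X"
  shows "orbit_of H x = orbit_of H y \<longleftrightarrow> (\<exists>h\<in>H. y = h x)"
proof
  assume "orbit_of H x = orbit_of H y"
  then have "y \<in> orbit_of H x" using orbit_of_refl[OF assms(2)] by simp
  then show "\<exists>h\<in>H. y = h x" by (auto simp: orbit_of_def)
next
  assume "\<exists>h\<in>H. y = h x"
  then show "orbit_of H x = orbit_of H y" using orbit_of_act[OF assms(1)] by auto
qed

lemma orbit_proj_orbit_of: "x \<in> topspace X \<Longrightarrow> orbit_proj p (orbit_of H x) = p x"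
proof -
  assume x: "x \<in> topspace X"
  have "p (h x) = p x" if "h \<in> H" for h using deck[OF that] deck_transformationsD(4) x by metis
  then have "p ` orbit_of H x = {p x}"
    using orbit_of_refl[OF x] unfolding orbit_of_def by auto
  then show ?thesis by (simp add: orbit_proj_def)
qed

end

lemma topspace_orbit_space [simp]: "topspace (orbit_space X H) = orbit_of H ` topspace X"
proof
  show "topspace (orbit_space X H) \<subseteq> orbit_of H ` topspace X"
    using openin_topspace[of "orbit_space X H"] unfolding openin_orbit_space by blast
  have "{x \<in> topspace X. orbit_of H x \<in> orbit_of H ` topspace X} = topspace X" by auto
  then have "openin (orbit_space X H) (orbit_of H ` topspace X)"
    unfolding openin_orbit_space by simp
  then show "orbit_of H ` topspace X \<subseteq> topspace (orbit_space X H)" by (rule openin_subset)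
qed

lemma continuous_map_orbit_of: "continuous_map X (orbit_space X H) (orbit_of H)"
  by (auto simp: continuous_map_def openin_orbit_space)

lemma continuous_map_from_orbit_space:
  assumes "continuous_map X Y (f \<circ> orbit_of H)"
  shows "continuous_map (orbit_space X H) Y f"
  unfolding continuous_map_def
proof (intro conjI allI impI)
  show "f \<in> topspace (orbit_space X H) \<rightarrow> topspace Y"
    using assms by (auto simp: continuous_map_def)
  fix V assume "openin Y V"
  then have "openin X {x \<in> topspace X. (f \<circ> orbit_of H) x \<in> V}"
    using assms openin_continuous_map_preimage by blast
  moreover have "{x \<in> topspace X. orbit_of H x \<in> {C \<in> topspace (orbit_space X H). f C \<in> V}} =
      {x \<in> topspace X. (f \<circ> orbit_of H) x \<in> V}" by auto
  ultimately show "openin (orbit_space X H) {C \<in> topspace (orbit_space X H). f C \<in> V}"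
    unfolding openin_orbit_space by auto
qed

text \<open>If \<open>s\<close> gives sections of \<open>p\<close> over a connected set, then \<open>s (h x) u = h (s x u)\<close> for \<open>h\<close> in \<open>H\<close>, so the
  image of the orbit of \<open>x\<close> under the map taking \<open>y\<close> to \<open>s y u\<close> is the orbit of \<open>s x u\<close>. This image serves as the
  section through an orbit: it depends on no choice of a representative.\<close>

lemma (in deck_subgroup) covering_map_orbit_proj:
  assumes B: "locally_path_connected_space B" and p: "covering_map X p B"
  shows "covering_map (orbit_space X H) (orbit_proj p) B"
  unfolding covering_map_iff_sections_over
proof (intro conjI ballI)
  let ?Z = "orbit_space X H"
  show "continuous_map ?Z B (orbit_proj p)"
    by (rule continuous_map_from_orbit_space)
      (rule continuous_map_eq[OF covering_mapD(1)[OF p]], simp add: orbit_proj_orbit_of)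
  show "orbit_proj p ` topspace ?Z = topspace B"
    using covering_mapD(2)[OF p] by (simp add: image_image orbit_proj_orbit_of)
  fix b assume b: "b \<in> topspace B"
  obtain U s where U: "b \<in> U" "U \<subseteq> topspace B" "path_connectedin B U" and s: "sections_over X p B U s"
    by (rule sections_over_path_connected[OF p B openin_topspace b])
  have conn: "connectedin B U" using U(3) path_connectedin_imp_connectedin by blast
  define t where "t = (\<lambda>C u. (\<lambda>x. s x u) ` C)"
  have hs: "h (s x u) = s (h x) u" if "h \<in> H" "x \<in> topspace X" "p x \<in> U" "u \<in> U" for h x u
    using morphism_sections[OF p _ _ conn s s that(2-4)] deck_transformationsD(2,4)[OF deck[OF that(1)]]
    by blast
  have t: "t (orbit_of H x) u = orbit_of H (s x u)" if "x \<in> topspace X" "p x \<in> U" "u \<in> U" for x u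
    unfolding t_def orbit_of_def image_image using hs that by simp
  have "sections_over ?Z (orbit_proj p) B U t"
    unfolding sections_over_def
  proof (intro conjI ballI impI)
    show "openin B U" by (rule sections_over_openin[OF s])
    then have top: "topspace (subtopology B U) = U" using openin_subset by auto
    fix C assume "C \<in> topspace ?Z" "orbit_proj p C \<in> U"
    then obtain x where x: "x \<in> topspace X" "p x \<in> U" and C: "C = orbit_of H x"
      by (auto simp: orbit_proj_orbit_of)
    note D = sections_overD[OF s x]
    have "continuous_map (subtopology B U) ?Z (orbit_of H \<circ> s x)"
      using D(1) continuous_map_orbit_of continuous_map_compose by blast
    then show "continuous_map (subtopology B U) ?Z (t C)"
      by (rule continuous_map_eq) (use t[OF x] C top in auto)
    show "orbit_proj p (t C u) = u" if "u \<in> U" for u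
      using t[OF x that] C D(2,6)[OF that] orbit_proj_orbit_of by simp
    show "t C (orbit_proj p C) = C"
      using t[OF x x(2)] D(3) C orbit_proj_orbit_of[OF x(1)] by simp
    show "t (t C u) v = t C v" if "u \<in> U" "v \<in> U" for u v
      using t[OF D(6)[OF that(1)] _ that(2)] D(2,5) t[OF x] that C by simp
    have "{y \<in> topspace X. orbit_of H y \<in> t C ` U} = (\<Union>h\<in>H. s (h x) ` U)"
    proof (intro equalityI subsetI)
      fix y assume "y \<in> {y \<in> topspace X. orbit_of H y \<in> t C ` U}"
      then obtain u where u: "u \<in> U" "y \<in> topspace X" "orbit_of H (s x u) = orbit_of H y"
        using t[OF x] C by auto
      then obtain h where "h \<in> H" "y = h (s x u)" using orbit_of_eq_iff D(6) by metis
      then show "y \<in> (\<Union>h\<in>H. s (h x) ` U)" using hs x u by auto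
    next
      fix y assume "y \<in> (\<Union>h\<in>H. s (h x) ` U)"
      then obtain h u where h: "h \<in> H" "u \<in> U" "y = h (s x u)" using hs x by auto
      then have "orbit_of H y = t C u" using orbit_of_act D(6) t[OF x] C by simp
      moreover have "y \<in> topspace X"
        using deck_transformationsD(5)[OF deck[OF h(1)] D(6)[OF h(2)]] h(3) by simp
      ultimately show "y \<in> {y \<in> topspace X. orbit_of H y \<in> t C ` U}" using h by blast
    qed
    moreover have "openin X (s (h x) ` U)" if "h \<in> H" for h
      using sections_overD(4)[OF s] deck_transformationsD(4,5)[OF deck[OF that] x(1)] x(2) by simp
    moreover have "t C ` U \<subseteq> orbit_of H ` topspace X" using t[OF x] C D(6) by auto
    ultimately show "openin ?Z (t C ` U)"
      unfolding openin_orbit_space by auto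
  qed
  then show "\<exists>U t. b \<in> U \<and> sections_over ?Z (orbit_proj p) B U t" using U(1) by blast
qed

text \<open>Invertibility of the morphisms comes for free: one taking \<open>x\<close> to \<open>y\<close> and one taking \<open>y\<close> to \<open>x\<close>
  compose to morphisms with a fixed point, which are identities by unique lifting.\<close>

lemma regular_covering_space_ofI:
  assumes X: "covering_space_of M X p"
    and ex: "\<And>x y. x \<in> topspace X \<Longrightarrow> y \<in> topspace X \<Longrightarrow> p x = p y \<Longrightarrow>
      \<exists>e. continuous_map X X e \<and> (\<forall>z\<in>topspace X. p (e z) = p z) \<and> e x = y"
  shows "regular_covering_space_of M X p"
  unfolding regular_covering_space_of_def
proof (intro conjI X ballI impI)
  fix x y assume xy: "x \<in> topspace X" "y \<in> topspace X" "p x = p y"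
  obtain e where e: "continuous_map X X e" "\<And>z. z \<in> topspace X \<Longrightarrow> p (e z) = p z" "e x = y"
    using ex[OF xy] by blast
  obtain d where d: "continuous_map X X d" "\<And>z. z \<in> topspace X \<Longrightarrow> p (d z) = p z" "d y = x"
    using ex[OF xy(2,1)] xy(3) by auto
  have C: "connected_space X" and p: "covering_map X p (mtopology_of M)"
    using X by (auto simp: covering_space_of_def)
  have inverse: "g (f z) = z"
    if "continuous_map X X f" "continuous_map X X g" "w \<in> topspace X" "g (f w) = w" "z \<in> topspace X"
      "\<And>z. z \<in> topspace X \<Longrightarrow> p (f z) = p z" "\<And>z. z \<in> topspace X \<Longrightarrow> p (g z) = p z" for f g w z
  proof -
    have fX: "f z \<in> topspace X" if "z \<in> topspace X" for z
      using that \<open>continuous_map X X f\<close> by (auto simp: continuous_map_def)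
    have "p ((g \<circ> f) c) = p (id c)" if "c \<in> topspace X" for c
      using \<open>\<And>z. z \<in> topspace X \<Longrightarrow> p (f z) = p z\<close> \<open>\<And>z. z \<in> topspace X \<Longrightarrow> p (g z) = p z\<close> fX that
      by simp
    then have "(g \<circ> f) z = id z"
      using unique_lifting[OF p C continuous_map_compose[OF that(1,2)] continuous_map_id _ that(3)] that(4,5)
      by (metis comp_apply id_apply)
    then show ?thesis by simp
  qed
  have "homeomorphic_maps X X e d"
    unfolding homeomorphic_maps_def
    using e(1) d(1) inverse[OF e(1) d(1) xy(1) _ _ e(2) d(2)] inverse[OF d(1) e(1) xy(2) _ _ d(2) e(2)] e(3) d(3)
    by auto
  then have "restrict e (topspace X) \<in> deck_transformations X p"
    by (rule deck_transformationsI) (rule e(2))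
  then show "\<exists>g\<in>deck_transformations X p. g x = y"
    using e(3) xy(1) by (intro bexI[of _ "restrict e (topspace X)"]) simp_all
qed

text \<open>A deck transformation \<open>g\<close> of \<open>X\<close> maps orbits of a normal subgroup onto orbits, so taking images
  under \<open>g\<close> is a morphism of the orbit space.\<close>

lemma regular_covering_orbit_space:
  assumes B: "locally_path_connected_space (mtopology_of M)"
    and X: "regular_covering_space_of M X p" and N: "H \<lhd> deck_group X p"
  shows "regular_covering_space_of M (orbit_space X H) (orbit_proj p)"
proof (rule regular_covering_space_ofI)
  let ?Z = "orbit_space X H" let ?G = "deck_group X p"
  interpret deck_subgroup X p H
    by (rule deck_subgroup.intro[OF normal_imp_subgroup[OF N]])
  have C: "connected_space X" and p: "covering_map X p (mtopology_of M)"
    using X by (auto simp: covering_space_of_def regular_covering_space_of_def)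
  have "connected_space ?Z"
    using connectedin_continuous_map_image[OF continuous_map_orbit_of[of X H], of "topspace X"] C
    by (simp add: connectedin_topspace flip: topspace_orbit_space)
  then show "covering_space_of M ?Z (orbit_proj p)"
    using covering_map_orbit_proj[OF B p] by (simp add: covering_space_of_def)
  fix C C' assume "C \<in> topspace ?Z" "C' \<in> topspace ?Z" "orbit_proj p C = orbit_proj p C'"
  then obtain x x' where x: "x \<in> topspace X" "C = orbit_of H x" and x': "x' \<in> topspace X" "C' = orbit_of H x'"
    and "p x = p x'" by (auto simp: orbit_proj_orbit_of)
  then obtain g where g: "g \<in> deck_transformations X p" and gx: "g x = x'"
    using X by (auto simp: regular_covering_space_of_def)
  note D = deck_transformationsD[OF g]
  have go: "g ` orbit_of H y = orbit_of H (g y)" if y: "y \<in> topspace X" for y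
  proof (intro equalityI subsetI)
    fix w assume "w \<in> g ` orbit_of H y"
    then obtain h where h: "h \<in> H" "w = g (h y)" by (auto simp: orbit_of_def)
    let ?c = "g \<otimes>\<^bsub>?G\<^esub> h \<otimes>\<^bsub>?G\<^esub> inv\<^bsub>?G\<^esub> g"
    have c: "?c \<in> H" using normal.inv_op_closed2[OF N, of g h] g h by (simp add: carrier_deck_group)
    interpret G: group ?G by (rule group_deck_group)
    have "?c \<otimes>\<^bsub>?G\<^esub> g = g \<otimes>\<^bsub>?G\<^esub> h"
      using g deck[OF h(1)] by (simp add: G.m_assoc flip: carrier_deck_group)
    then have "?c (g y) = w"
      using deck_group_mult_apply[OF deck[OF c] g y] deck_group_mult_apply[OF g deck[OF h(1)] y] h(2) by simp
    then show "w \<in> orbit_of H (g y)" using c by (auto simp: orbit_of_def)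
  next
    fix w assume "w \<in> orbit_of H (g y)"
    then obtain h where h: "h \<in> H" "w = h (g y)" by (auto simp: orbit_of_def)
    let ?c = "inv\<^bsub>?G\<^esub> g \<otimes>\<^bsub>?G\<^esub> h \<otimes>\<^bsub>?G\<^esub> g"
    have c: "?c \<in> H" using normal.inv_op_closed1[OF N, of g h] g h by (simp add: carrier_deck_group)
    interpret G: group ?G by (rule group_deck_group)
    have "g \<otimes>\<^bsub>?G\<^esub> ?c = h \<otimes>\<^bsub>?G\<^esub> g"
      using g deck[OF h(1)] by (simp flip: G.m_assoc carrier_deck_group)
    then have "g (?c y) = w"
      using deck_group_mult_apply[OF deck[OF h(1)] g y] deck_group_mult_apply[OF g deck[OF c] y] h(2) by simp
    then show "w \<in> g ` orbit_of H y" using c by (auto simp: orbit_of_def)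
  qed
  show "\<exists>e. continuous_map ?Z ?Z e \<and> (\<forall>D\<in>topspace ?Z. orbit_proj p (e D) = orbit_proj p D) \<and> e C = C'"
  proof (intro exI[of _ "(`) g"] conjI)
    have "continuous_map X ?Z (orbit_of H \<circ> g)"
      using continuous_map_compose[OF D(2) continuous_map_orbit_of] .
    then have "continuous_map X ?Z ((`) g \<circ> orbit_of H)"
      by (rule continuous_map_eq) (simp add: go)
    then show "continuous_map ?Z ?Z ((`) g)" by (rule continuous_map_from_orbit_space)
    show "\<forall>D\<in>topspace ?Z. orbit_proj p (g ` D) = orbit_proj p D"
      using D(4,5) by (simp add: go orbit_proj_orbit_of)
    show "g ` C = C'" using go[OF x(1)] x(2) x'(2) gx by simp
  qed
qed

section \<open>Length spaces are locally path connected\<close>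

text \<open>Use the partition whose only points are \<open>0\<close> and \<open>t\<close>.\<close>

lemma mdist_le_curve_length:
  assumes "0 \<le> t" "t \<le> 1"
  shows "ereal (mdist M (\<gamma> 0) (\<gamma> t)) \<le> curve_length M \<gamma>"
proof -
  define \<tau> where "\<tau> = (\<lambda>i::nat. if i = 0 then 0 else t)"
  have "(1, \<tau>) \<in> {(n::nat, t::nat \<Rightarrow> real). mono_on {..n} t \<and> t ` {..n} \<subseteq> {0..1}}"
    using assms by (auto simp: \<tau>_def mono_on_def)
  then show ?thesis
    unfolding curve_length_def by (rule SUP_upper2) (simp add: \<tau>_def)
qed

text \<open>A minimizing curve from the centre of a ball to a point of the ball stays in the ball, because its
  length bounds the distance of each of its points from the centre.\<close>

lemma locally_path_connected_length_space:
  assumes "complete_length_space M"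
  shows "locally_path_connected_space (mtopology_of M)"
  unfolding locally_path_connected_space_im_kleinen
proof (intro allI impI)
  interpret Metric_space "mspace M" "mdist M" by (rule Metric_space_mspace_mdist)
  have top: "mtopology_of M = mtopology" by (simp add: mtopology_of_def)
  fix V x assume "openin (mtopology_of M) V \<and> x \<in> V"
  then obtain r where r: "r > 0" "mball x r \<subseteq> V" and x: "x \<in> mspace M"
    unfolding top openin_mtopology by blast
  have "\<exists>C. path_connectedin mtopology C \<and> C \<subseteq> V \<and> x \<in> C \<and> y \<in> C" if y: "y \<in> mball x r" for y
  proof -
    have "y \<in> mspace M" using y by simp
    then obtain \<gamma> where \<gamma>: "pathin mtopology \<gamma>" "\<gamma> 0 = x" "\<gamma> 1 = y"
      "curve_length M \<gamma> = ereal (mdist M x y)"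
      using assms x unfolding complete_length_space_def top by blast
    have cont: "continuous_map (top_of_set {0..1}) mtopology \<gamma>" using \<gamma>(1) by (simp add: pathin_def)
    have in_ball: "\<gamma> t \<in> mball x r" if t: "t \<in> {0..1}" for t
    proof -
      have "\<gamma> t \<in> mspace M" using cont t by (auto simp: continuous_map_def)
      moreover have "mdist M x (\<gamma> t) \<le> mdist M x y"
        using mdist_le_curve_length[of t M \<gamma>] t \<gamma>(2,4) by simp
      ultimately show ?thesis using x y by simp
    qed
    show ?thesis
    proof (intro exI[of _ "\<gamma> ` {0..1}"] conjI)
      show "path_connectedin mtopology (\<gamma> ` {0..1})" using path_connectedin_path_image[OF \<gamma>(1)] .
      show "\<gamma> ` {0..1} \<subseteq> V" using in_ball r by blast
      show "x \<in> \<gamma> ` {0..1}" "y \<in> \<gamma> ` {0..1}" using \<gamma>(2,3) by force+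
    qed
  qed
  then show "\<exists>U. openin (mtopology_of M) U \<and> x \<in> U \<and> U \<subseteq> V \<and>
      (\<forall>y\<in>U. \<exists>C. path_connectedin (mtopology_of M) C \<and> C \<subseteq> V \<and> x \<in> C \<and> y \<in> C)"
    using r x by (intro exI[of _ "mball x r"]) (auto simp: top)
qed

section \<open>Small models of covering spaces\<close>

lemma homeomorphic_copy:
  assumes inj: "inj_on i (topspace Y)"
  obtains Y' where "homeomorphic_maps Y Y' i (inv_into (topspace Y) i)"
proof -
  let ?j = "inv_into (topspace Y) i"
  define Y' where "Y' = pullback_topology (i ` topspace Y) ?j Y"
  have "continuous_map Y Y' i"
    unfolding Y'_def
    by (rule continuous_map_pullback', rule continuous_map_eq[OF continuous_map_id])
      (use inj in auto)
  moreover have "continuous_map Y' Y ?j"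
    unfolding Y'_def using continuous_map_pullback[OF continuous_map_id] by (metis id_comp)
  moreover have "topspace Y' \<subseteq> i ` topspace Y" by (auto simp: Y'_def topspace_pullback_topology)
  ultimately have "homeomorphic_maps Y Y' i ?j"
    unfolding homeomorphic_maps_def using inj by (auto simp: f_inv_into_f)
  then show ?thesis by (rule that)
qed

lemma covering_map_homeomorphic:
  assumes q: "covering_map Y q B" and h: "homeomorphic_maps Y Y' i j"
  shows "covering_map Y' (q \<circ> j) B"
  unfolding covering_map_iff_sections_over
proof (intro conjI ballI)
  have ij: "continuous_map Y Y' i" "continuous_map Y' Y j" "\<And>y. y \<in> topspace Y \<Longrightarrow> j (i y) = y"
    "\<And>y. y \<in> topspace Y' \<Longrightarrow> i (j y) = y" "\<And>y. y \<in> topspace Y \<Longrightarrow> i y \<in> topspace Y'"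
    "\<And>y. y \<in> topspace Y' \<Longrightarrow> j y \<in> topspace Y"
    using h by (auto simp: homeomorphic_maps_def continuous_map_def)
  show "continuous_map Y' B (q \<circ> j)" using ij(2) covering_mapD(1)[OF q] continuous_map_compose by blast
  have "j ` topspace Y' = topspace Y" using ij(3,5,6) by force
  then show "(q \<circ> j) ` topspace Y' = topspace B" using covering_mapD(2)[OF q] by (simp flip: image_image add: image_comp[symmetric])
  fix b assume b: "b \<in> topspace B"
  obtain U s where U: "b \<in> U" and s: "sections_over Y q B U s"
    by (rule covering_map_sectionsE[OF q b])
  have "sections_over Y' (q \<circ> j) B U (\<lambda>y u. i (s (j y) u))"
    unfolding sections_over_def
  proof (intro conjI ballI impI sections_over_openin[OF s])
    fix y assume y: "y \<in> topspace Y'" "(q \<circ> j) y \<in> U"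
    then have jy: "j y \<in> topspace Y" "q (j y) \<in> U" using ij(6) by auto
    note D = sections_overD[OF s jy]
    show "continuous_map (subtopology B U) Y' (\<lambda>u. i (s (j y) u))"
      using continuous_map_compose[OF D(1) ij(1)] by (simp add: o_def)
    show "(q \<circ> j) (i (s (j y) u)) = u" if "u \<in> U" for u using D(2,6)[OF that] ij(3) by simp
    show "i (s (j y) ((q \<circ> j) y)) = y" using D(3) ij(4) y by simp
    show "i (s (j (i (s (j y) u))) v) = i (s (j y) v)" if "u \<in> U" "v \<in> U" for u v
      using D(5)[OF that] D(6)[OF that(1)] ij(3) by simp
    have "(\<lambda>u. i (s (j y) u)) ` U = {z \<in> topspace Y'. j z \<in> s (j y) ` U}"
      using D(6) ij(3,4,5) by (auto, metis image_eqI)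
    then show "openin Y' ((\<lambda>u. i (s (j y) u)) ` U)"
      using openin_continuous_map_preimage[OF ij(2) D(4)] by simp
  qed
  then show "\<exists>U s. b \<in> U \<and> sections_over Y' (q \<circ> j) B U s" using U by (intro exI conjI)
qed

lemma path_component_of_covering_space:
  assumes B: "locally_path_connected_space B" and q: "covering_map Y q B" and Y: "connected_space Y"
    and y: "y0 \<in> topspace Y" "y \<in> topspace Y"
  shows "path_component_of Y y0 y"
proof -
  have nbhd: "\<exists>T. openin Y T \<and> z \<in> T \<and> (\<forall>w\<in>T. path_component_of Y z w)" if z: "z \<in> topspace Y" for z
  proof -
    obtain U s where U: "q z \<in> U" "U \<subseteq> topspace B" "path_connectedin B U" and s: "sections_over Y q B U s"
      by (rule sections_over_path_connected[OF q B openin_topspace covering_mapD(3)[OF q z]])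
    note D = sections_overD[OF s z U(1)]
    have "path_connectedin (subtopology B U) U" using U(3) by (simp add: path_connectedin_subtopology)
    then have "path_connectedin Y (s z ` U)" using path_connectedin_continuous_map_image[OF D(1)] by blast
    moreover have "z \<in> s z ` U" using D(3) U(1) by force
    ultimately show ?thesis using D(4) path_component_of_maximal[of Y "s z ` U" z]
      by (intro exI[of _ "s z ` U"]) auto
  qed
  let ?P = "{z. path_component_of Y y0 z}"
  have PY: "?P \<subseteq> topspace Y" by (rule path_component_of_subset_topspace)
  have "openin Y ?P"
  proof (subst openin_subopen, intro ballI)
    fix z assume "z \<in> ?P"
    then show "\<exists>T. openin Y T \<and> z \<in> T \<and> T \<subseteq> ?P"
      using nbhd[of z] PY path_component_of_trans[of Y y0 z] by blast
  qed
  moreover have "openin Y (topspace Y - ?P)"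
  proof (subst openin_subopen, intro ballI)
    fix z assume z: "z \<in> topspace Y - ?P"
    then obtain T where T: "openin Y T" "z \<in> T" "\<forall>w\<in>T. path_component_of Y z w" using nbhd[of z] by blast
    have "\<not> path_component_of Y y0 w" if "w \<in> T" for w
      using path_component_of_trans[of Y y0 w z] T(3) that z by (auto simp: path_component_of_sym)
    then show "\<exists>T. openin Y T \<and> z \<in> T \<and> T \<subseteq> topspace Y - ?P"
      using T openin_subset by blast
  qed
  moreover have "y0 \<in> ?P" using y(1) by (simp add: path_component_of_refl)
  ultimately have "?P = topspace Y"
    using Y PY unfolding connected_space_clopen_in closedin_def by blast
  then show ?thesis using y(2) by blast
qed

text \<open>A point \<open>y\<close> is encoded by the set of projections of all paths from a fixed base point to \<open>y\<close>. By
  unique lifting the projection of a path determines its end point, so sets belonging to different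
  points are disjoint; they are nonempty because \<open>Y\<close> is path connected.\<close>

lemma covering_space_copy_path_set:
  fixes M :: "'a metric" and Y :: "'y topology"
  assumes B: "locally_path_connected_space (mtopology_of M)" and Y: "covering_space_of M Y q"
  obtains Y' :: "'a path_set topology" and i j where
    "homeomorphic_maps Y Y' i j" "covering_space_of M Y' (q \<circ> j)"
proof -
  have C: "connected_space Y" and q: "covering_map Y q (mtopology_of M)"
    using Y by (auto simp: covering_space_of_def)
  have "\<exists>i :: 'y \<Rightarrow> 'a path_set. inj_on i (topspace Y)"
  proof (cases "topspace Y = {}")
    case False
    then obtain y0 where y0: "y0 \<in> topspace Y" by blast
    define i where "i = (\<lambda>y. {q \<circ> \<gamma> |\<gamma>. pathin Y \<gamma> \<and> \<gamma> 0 = y0 \<and> \<gamma> 1 = y})"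
    have "inj_on i (topspace Y)"
    proof (rule inj_onI)
      fix y z assume yz: "y \<in> topspace Y" "z \<in> topspace Y" "i y = i z"
      obtain \<gamma> where \<gamma>: "pathin Y \<gamma>" "\<gamma> 0 = y0" "\<gamma> 1 = y"
        using path_component_of_covering_space[OF B q C y0 yz(1)] by (auto simp: path_component_of_def)
      then have "q \<circ> \<gamma> \<in> i z" using yz(3) by (auto simp: i_def)
      then obtain \<delta> where \<delta>: "pathin Y \<delta>" "\<delta> 0 = y0" "\<delta> 1 = z" "q \<circ> \<gamma> = q \<circ> \<delta>"
        by (auto simp: i_def)
      have "\<gamma> 1 = \<delta> 1"
      proof (rule unique_lifting[OF q, of "top_of_set {0..1}" \<gamma> \<delta> 0])
        show "connected_space (top_of_set {0..1::real})" 
          using connected_Icc[of 0 "1::real"] by (simp add: connected_space_subtopology)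
        show "q (\<gamma> c) = q (\<delta> c)" for c using \<delta>(4) by (metis comp_apply)
      qed (use \<gamma> \<delta> in \<open>auto simp: pathin_def\<close>)
      then show "y = z" using \<gamma> \<delta> by simp
    qed
    then show ?thesis by blast
  qed auto
  then obtain i :: "'y \<Rightarrow> 'a path_set" where i: "inj_on i (topspace Y)" by blast
  obtain Y' where h: "homeomorphic_maps Y Y' i (inv_into (topspace Y) i)" using homeomorphic_copy[OF i] .
  have "connected_space Y'"
    using C homeomorphic_connected_space h homeomorphic_maps_imp_homeomorphic_space by blast
  then show ?thesis
    using that[OF h] covering_map_homeomorphic[OF q h] by (simp add: covering_space_of_def)
qed

section \<open>A universal cover is regular\<close>

text \<open>A sheet over a connected set lies in one component, so the component inherits the sections of
  \<open>W\<close>; by the same token its image in the connected base is open and closed, so it is everything.\<close>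

lemma covering_map_connected_component:
  assumes B: "locally_path_connected_space B" "connected_space B"
    and q: "covering_map W q B" and w: "w \<in> topspace W"
  defines "C \<equiv> connected_component_of_set W w"
  shows "covering_map (subtopology W C) q B"
proof -
  let ?Y = "subtopology W C"
  have CW: "C \<subseteq> topspace W" unfolding C_def by (rule connected_component_of_subset_topspace)
  have wC: "w \<in> C" unfolding C_def using w by (simp add: connected_component_of_refl)
  have cont: "continuous_map ?Y B q"
    using covering_mapD(1)[OF q] by (rule continuous_map_from_subtopology)
  have nbhd: "\<exists>U s. b \<in> U \<and> sections_over ?Y q B U s \<and> (\<forall>y\<in>C. q y \<in> U \<longrightarrow> U \<subseteq> q ` C)"
    if b: "b \<in> topspace B" for b
  proof -
    obtain U s where U: "b \<in> U" "U \<subseteq> topspace B" "path_connectedin B U" and s: "sections_over W q B U s"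
      by (rule sections_over_path_connected[OF q B(1) openin_topspace b])
    have conn: "connectedin (subtopology B U) U"
      using U(3) path_connectedin_imp_connectedin by (auto simp: connectedin_subtopology)
    have sC: "s y ` U \<subseteq> C" if y: "y \<in> C" "q y \<in> U" for y
    proof -
      have yW: "y \<in> topspace W" using CW y(1) by blast
      note D = sections_overD[OF s yW y(2)]
      have "connectedin W (s y ` U)" using connectedin_continuous_map_image[OF D(1) conn] .
      moreover have "y \<in> s y ` U" using D(3) y(2) by force
      ultimately have "s y ` U \<subseteq> connected_component_of_set W y" by (rule connected_component_of_maximal)
      moreover have "connected_component_of W w = connected_component_of W y"
        using y(1) unfolding C_def by (simp add: connected_component_of_equiv)
      ultimately show ?thesis unfolding C_def by simp
    qed
    have "sections_over ?Y q B U s"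
      unfolding sections_over_def
    proof (intro conjI ballI impI)
      show "openin B U" by (rule sections_over_openin[OF s])
      fix y assume "y \<in> topspace ?Y" and yU: "q y \<in> U"
      then have y: "y \<in> C" "y \<in> topspace W" by auto
      note D = sections_overD[OF s y(2) yU]
      have top: "topspace (subtopology B U) = U" using U(2) by auto
      show "continuous_map (subtopology B U) ?Y (s y)"
        using D(1) sC[OF y(1) yU] top by (auto simp: continuous_map_in_subtopology)
      show "openin ?Y (s y ` U)"
        using D(4) sC[OF y(1) yU] CW by (metis openin_subtopology_Int2 inf.absorb2)
    qed (use sections_overD[OF s] in auto)
    moreover have "U \<subseteq> q ` C" if y: "y \<in> C" "q y \<in> U" for y
    proof
      fix u assume u: "u \<in> U"
      have "q (s y u) = u" using sections_overD(2)[OF s] CW y u by blast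
      then show "u \<in> q ` C" using sC[OF y] u by force
    qed
    ultimately show ?thesis using U(1) by (intro exI[of _ U] exI[of _ s]) simp
  qed
  have "openin B (q ` C)"
  proof (subst openin_subopen, intro ballI)
    fix b assume "b \<in> q ` C"
    then obtain y where y: "y \<in> C" "b = q y" by blast
    then have "b \<in> topspace B" using CW covering_mapD(3)[OF q] by blast
    then obtain U s where "b \<in> U" "sections_over ?Y q B U s" "\<forall>y\<in>C. q y \<in> U \<longrightarrow> U \<subseteq> q ` C"
      using nbhd[of b] by auto
    moreover from this have "U \<subseteq> q ` C" using y by blast
    ultimately show "\<exists>T. openin B T \<and> b \<in> T \<and> T \<subseteq> q ` C"
      using sections_over_openin[of ?Y q B U s] by auto
  qed
  moreover have "openin B (topspace B - q ` C)"
  proof (subst openin_subopen, intro ballI)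
    fix b assume b: "b \<in> topspace B - q ` C"
    then obtain U s where U: "b \<in> U" "sections_over ?Y q B U s" "\<forall>y\<in>C. q y \<in> U \<longrightarrow> U \<subseteq> q ` C"
      using nbhd[of b] by auto
    then have "U \<subseteq> topspace B - q ` C" using b sections_over_openin[OF U(2)] openin_subset by fastforce
    with U(1) sections_over_openin[OF U(2)] show "\<exists>T. openin B T \<and> b \<in> T \<and> T \<subseteq> topspace B - q ` C"
      by auto
  qed
  ultimately have "q ` C = {} \<or> q ` C = topspace B"
    using B(2) covering_mapD(3)[OF q] CW unfolding connected_space_clopen_in closedin_def
    by (metis openin_subset)
  then have "q ` topspace ?Y = topspace B" using wC CW by (auto simp: Int_absorb1)
  moreover have "\<exists>U s. b \<in> U \<and> sections_over ?Y q B U s" if "b \<in> topspace B" for b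
    using nbhd[OF that] by auto
  ultimately show ?thesis using cont by (simp add: covering_map_iff_sections_over)
qed

text \<open>The space \<open>W\<close> of the introduction. Its points are all surjections of the type \<open>'b\<close> onto
  a fibre: with a whole type as domain there is no convention to make about values outside the domain.
  Surjectivity makes every point of the fibre a value, which is what regularity asks for.\<close>

definition fibre_surjections :: "'b topology \<Rightarrow> ('b \<Rightarrow> 'a) \<Rightarrow> 'a topology \<Rightarrow> ('b \<Rightarrow> 'b) set" where
  "fibre_surjections X p B = {\<phi>. \<exists>b\<in>topspace B. range \<phi> = {x \<in> topspace X. p x = b}}"

text \<open>All values of a point of \<open>W\<close> lie over the same base point, so any argument will do; \<open>undefined\<close>
  is a fixed one.\<close>

definition fibre_proj :: "('b \<Rightarrow> 'a) \<Rightarrow> ('b \<Rightarrow> 'b) \<Rightarrow> 'a" where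
  "fibre_proj p \<phi> = p (\<phi> undefined)"

text \<open>The topology in which moving all values of \<open>\<phi>\<close> simultaneously along sections of \<open>X\<close> is a local
  section. In the product topology such a section need not have an open image, and in the box topology
  it need not be continuous. Requiring the condition for all \<open>U\<close> and \<open>s\<close>, with a neighbourhood \<open>N\<close> allowed to be smaller
  than \<open>U\<close>, makes closure under intersections immediate.\<close>

definition fibre_surjection_space :: "'b topology \<Rightarrow> ('b \<Rightarrow> 'a) \<Rightarrow> 'a topology \<Rightarrow> ('b \<Rightarrow> 'b) topology" where
  "fibre_surjection_space X p B = topology (\<lambda>V. V \<subseteq> fibre_surjections X p B \<and>
     (\<forall>\<phi>\<in>V. \<forall>U s. sections_over X p B U s \<and> fibre_proj p \<phi> \<in> U \<longrightarrow>
        (\<exists>N. openin B N \<and> fibre_proj p \<phi> \<in> N \<and> N \<subseteq> U \<and> (\<forall>u\<in>N. (\<lambda>z. s (\<phi> z) u) \<in> V))))"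

lemma openin_fibre_surjection_space:
  "openin (fibre_surjection_space X p B) V \<longleftrightarrow> V \<subseteq> fibre_surjections X p B \<and>
     (\<forall>\<phi>\<in>V. \<forall>U s. sections_over X p B U s \<and> fibre_proj p \<phi> \<in> U \<longrightarrow>
        (\<exists>N. openin B N \<and> fibre_proj p \<phi> \<in> N \<and> N \<subseteq> U \<and> (\<forall>u\<in>N. (\<lambda>z. s (\<phi> z) u) \<in> V)))"
proof -
  let ?P = "\<lambda>V \<phi> U s N. openin B N \<and> fibre_proj p \<phi> \<in> N \<and> N \<subseteq> U \<and> (\<forall>u\<in>N. (\<lambda>z. s (\<phi> z) u) \<in> V)"
  let ?O = "\<lambda>V. V \<subseteq> fibre_surjections X p B \<and>
     (\<forall>\<phi>\<in>V. \<forall>U s. sections_over X p B U s \<and> fibre_proj p \<phi> \<in> U \<longrightarrow> (\<exists>N. ?P V \<phi> U s N))"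
  have "istopology ?O"
    unfolding istopology_def
  proof (intro conjI allI impI ballI)
    fix S T \<phi> U s
    assume S: "?O S" and T: "?O T" and \<phi>: "\<phi> \<in> S \<inter> T" and U: "sections_over X p B U s \<and> fibre_proj p \<phi> \<in> U"
    obtain N where N: "?P S \<phi> U s N" using S \<phi> U by (meson IntD1)
    obtain N' where N': "?P T \<phi> U s N'" using T \<phi> U by (meson IntD2)
    show "\<exists>N. ?P (S \<inter> T) \<phi> U s N"
      using N N' by (intro exI[of _ "N \<inter> N'"]) auto
  next
    fix \<K> \<phi> U s
    assume K: "\<forall>K\<in>\<K>. ?O K" and \<phi>: "\<phi> \<in> \<Union>\<K>" and U: "sections_over X p B U s \<and> fibre_proj p \<phi> \<in> U"
    then obtain K where K': "K \<in> \<K>" "\<phi> \<in> K" by blast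
    with K U obtain N where "?P K \<phi> U s N" by meson
    with K' show "\<exists>N. ?P (\<Union>\<K>) \<phi> U s N" by (intro exI[of _ N]) auto
  qed auto
  then show ?thesis unfolding fibre_surjection_space_def by simp
qed

text \<open>Sections through the same point over different sets agree on a connected set inside both: apply
  \<open>morphism_sections\<close> to the identity.\<close>

lemma sections_over_agree:
  assumes p: "covering_map X p B" and s: "sections_over X p B U s" and s': "sections_over X p B U' s'"
    and N: "openin B N" "connectedin B N" "N \<subseteq> U" "N \<subseteq> U'"
    and x: "x \<in> topspace X" "p x \<in> N" and u: "u \<in> N"
  shows "s x u = s' x u"
proof -
  note res = sections_over_subset[OF _ covering_mapD(1)[OF p] N(1)]
  show ?thesis
    using morphism_sections[OF p continuous_map_id[unfolded id_def] refl N(2) res[OF s N(3)] res[OF s' N(4)] x u] .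
qed

text \<open>Transport along a section keeps surjectivity onto the fibre: the point \<open>x\<close> over \<open>u\<close> comes from the
  point of the old fibre that lies on the sheet of \<open>x\<close>.\<close>

lemma fibre_surjection_transport:
  assumes s: "sections_over X p B U s" and \<phi>: "\<phi> \<in> fibre_surjections X p B" "fibre_proj p \<phi> \<in> U" and u: "u \<in> U"
  shows "(\<lambda>z. s (\<phi> z) u) \<in> fibre_surjections X p B" "fibre_proj p (\<lambda>z. s (\<phi> z) u) = u"
    "\<And>z. \<phi> z \<in> topspace X" "\<And>z. p (\<phi> z) = fibre_proj p \<phi>"
proof -
  obtain b where b: "range \<phi> = {x \<in> topspace X. p x = b}" using \<phi>(1) by (auto simp: fibre_surjections_def)
  then show X: "\<phi> z \<in> topspace X" for z by blast
  have pb: "p (\<phi> z) = b" for z using b by blast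
  then have fb: "fibre_proj p \<phi> = b" by (simp add: fibre_proj_def)
  show pz: "p (\<phi> z) = fibre_proj p \<phi>" for z using pb fb by simp
  have U: "p (\<phi> z) \<in> U" for z using pz \<phi>(2) by simp
  note D = sections_overD[OF s X U]
  show "fibre_proj p (\<lambda>z. s (\<phi> z) u) = u" using D(2)[OF u] by (simp add: fibre_proj_def)
  have "range (\<lambda>z. s (\<phi> z) u) = {x \<in> topspace X. p x = u}"
  proof (intro equalityI subsetI)
    fix x assume x: "x \<in> {x \<in> topspace X. p x = u}"
    then have x': "x \<in> topspace X" "p x \<in> U" using u by auto
    have bU: "b \<in> U" using fb \<phi>(2) by simp
    note E = sections_overD[OF s x']
    have "s x b \<in> range \<phi>" using E(2,6)[OF bU] b by simp
    then obtain z where "\<phi> z = s x b" by auto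
    then have "s (\<phi> z) u = x" using E(5)[OF bU u] E(3) x by simp
    then show "x \<in> range (\<lambda>z. s (\<phi> z) u)" by blast
  qed (use D(2,6)[OF u] in auto)
  moreover have "u \<in> topspace B" using openin_subset[OF sections_over_openin[OF s]] u by blast
  ultimately show "(\<lambda>z. s (\<phi> z) u) \<in> fibre_surjections X p B" by (auto simp: fibre_surjections_def)
qed

lemma fibre_surjectionD:
  assumes "\<phi> \<in> fibre_surjections X p B"
  shows "range \<phi> = {x \<in> topspace X. p x = fibre_proj p \<phi>}" "fibre_proj p \<phi> \<in> topspace B"
proof -
  obtain b where b: "b \<in> topspace B" "range \<phi> = {x \<in> topspace X. p x = b}"
    using assms by (auto simp: fibre_surjections_def)
  then have "\<phi> undefined \<in> {x \<in> topspace X. p x = b}" by blast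
  then have "fibre_proj p \<phi> = b" by (simp add: fibre_proj_def)
  then show "range \<phi> = {x \<in> topspace X. p x = fibre_proj p \<phi>}" "fibre_proj p \<phi> \<in> topspace B"
    using b by simp_all
qed

lemma topspace_fibre_surjection_space [simp]:
  "topspace (fibre_surjection_space X p B) = fibre_surjections X p B"
proof
  show "topspace (fibre_surjection_space X p B) \<subseteq> fibre_surjections X p B"
    using openin_topspace[of "fibre_surjection_space X p B"] unfolding openin_fibre_surjection_space by blast
  have "openin (fibre_surjection_space X p B) (fibre_surjections X p B)"
    unfolding openin_fibre_surjection_space
    using fibre_surjection_transport(1) sections_over_openin by (metis order_refl)
  then show "fibre_surjections X p B \<subseteq> topspace (fibre_surjection_space X p B)" by (rule openin_subset)
qed

text \<open>Transport by the sections of \<open>X\<close> gives sections of \<open>W\<close> over the same sets. That their images are open is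
  where local connectedness enters: near a point, transport along any other choice of sections is the same.\<close>

lemma covering_map_fibre_proj:
  assumes B: "locally_path_connected_space B" and p: "covering_map X p B"
  shows "covering_map (fibre_surjection_space X p B) (fibre_proj p) B"
  unfolding covering_map_iff_sections_over
proof (intro conjI ballI)
  let ?W = "fibre_surjection_space X p B" and ?S = "fibre_surjections X p B"
  show "continuous_map ?W B (fibre_proj p)"
    unfolding continuous_map_def
  proof (intro conjI allI impI)
    show "fibre_proj p \<in> topspace ?W \<rightarrow> topspace B" using fibre_surjectionD(2) by auto
    fix O' assume O': "openin B O'"
    show "openin ?W {\<phi> \<in> topspace ?W. fibre_proj p \<phi> \<in> O'}"
      unfolding openin_fibre_surjection_space
    proof (intro conjI ballI allI impI)
      fix \<phi> U s assume "\<phi> \<in> {\<phi> \<in> topspace ?W. fibre_proj p \<phi> \<in> O'}" and U: "sections_over X p B U s \<and> fibre_proj p \<phi> \<in> U"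
      then show "\<exists>N. openin B N \<and> fibre_proj p \<phi> \<in> N \<and> N \<subseteq> U \<and>
          (\<forall>u\<in>N. (\<lambda>z. s (\<phi> z) u) \<in> {\<phi> \<in> topspace ?W. fibre_proj p \<phi> \<in> O'})"
        using fibre_surjection_transport(1,2)[of X p B U s \<phi>] O' sections_over_openin[of X p B U s]
        by (intro exI[of _ "U \<inter> O'"]) auto
    qed auto
  qed
  have "\<exists>\<phi>. \<phi> \<in> ?S \<and> fibre_proj p \<phi> = b" if b: "b \<in> topspace B" for b
  proof -
    have "b \<in> p ` topspace X" using covering_mapD(2)[OF p] b by simp
    then obtain x where x: "x \<in> topspace X" "p x = b" by auto
    \<comment> \<open>Points outside the fibre are sent to an arbitrary point of it.\<close>
    define \<phi> where "\<phi> = (\<lambda>y. if y \<in> topspace X \<and> p y = b then y else x)"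
    have "\<phi> y \<in> {x \<in> topspace X. p x = b}" for y using x by (simp add: \<phi>_def)
    moreover have "y = \<phi> y" if "y \<in> {x \<in> topspace X. p x = b}" for y using that by (simp add: \<phi>_def)
    ultimately have "range \<phi> = {x \<in> topspace X. p x = b}" by blast
    then have "\<phi> \<in> ?S" using b by (auto simp: fibre_surjections_def)
    moreover have "fibre_proj p \<phi> = b" using x by (auto simp: \<phi>_def fibre_proj_def)
    ultimately show ?thesis by blast
  qed
  then show "fibre_proj p ` topspace ?W = topspace B"
    using fibre_surjectionD(2) by (auto simp: image_iff)
  fix b assume b: "b \<in> topspace B"
  obtain U s where U: "b \<in> U" and s: "sections_over X p B U s"
    by (rule covering_map_sectionsE[OF p b])
  note UB = sections_over_openin[OF s]
  have "sections_over ?W (fibre_proj p) B U (\<lambda>\<phi> u z. s (\<phi> z) u)"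
    unfolding sections_over_def
  proof (intro conjI ballI impI UB)
    fix \<phi> assume "\<phi> \<in> topspace ?W" and qU: "fibre_proj p \<phi> \<in> U"
    then have \<phi>: "\<phi> \<in> ?S" by simp
    note T = fibre_surjection_transport[OF s \<phi> qU]
    have X: "\<phi> z \<in> topspace X" "p (\<phi> z) = fibre_proj p \<phi>" "p (\<phi> z) \<in> U" for z
      using T(3,4) qU by auto
    note D = sections_overD[OF s X(1,3)]
    show "fibre_proj p (\<lambda>z. s (\<phi> z) u) = u" if "u \<in> U" for u using T(2)[OF that] .
    show "(\<lambda>z. s (\<phi> z) (fibre_proj p \<phi>)) = \<phi>" 
      by (rule ext) (use D(3) X(2) in simp)
    show *: "(\<lambda>z. s (s (\<phi> z) u) v) = (\<lambda>z. s (\<phi> z) v)" if "u \<in> U" "v \<in> U" for u v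
      using D(5)[OF that] by simp
    show "continuous_map (subtopology B U) ?W (\<lambda>u z. s (\<phi> z) u)"
      unfolding continuous_map_def
    proof (intro conjI allI impI)
      show "(\<lambda>u z. s (\<phi> z) u) \<in> topspace (subtopology B U) \<rightarrow> topspace ?W" using T(1) by auto
      fix V assume V: "openin ?W V"
      show "openin (subtopology B U) {u \<in> topspace (subtopology B U). (\<lambda>z. s (\<phi> z) u) \<in> V}"
      proof (subst openin_subopen, intro ballI)
        fix u assume "u \<in> {u \<in> topspace (subtopology B U). (\<lambda>z. s (\<phi> z) u) \<in> V}"
        then have u: "u \<in> U" "(\<lambda>z. s (\<phi> z) u) \<in> V" by auto
        obtain N where N: "openin B N" "u \<in> N" "N \<subseteq> U" "\<forall>v\<in>N. (\<lambda>z. s (s (\<phi> z) u) v) \<in> V"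
          using V u s T(2)[OF u(1)] unfolding openin_fibre_surjection_space by metis
        then have "openin (subtopology B U) N" by (simp add: openin_open_subtopology UB)
        moreover have "N \<subseteq> {u \<in> topspace (subtopology B U). (\<lambda>z. s (\<phi> z) u) \<in> V}"
        proof
          fix v assume v: "v \<in> N"
          then have "(\<lambda>z. s (\<phi> z) v) \<in> V" using N(3,4) *[OF u(1), of v] by (metis subsetD)
          then show "v \<in> {u \<in> topspace (subtopology B U). (\<lambda>z. s (\<phi> z) u) \<in> V}"
            using v N(3) openin_subset[OF N(1)] by auto
        qed
        ultimately show "\<exists>T. openin (subtopology B U) T \<and> u \<in> T \<and>
            T \<subseteq> {u \<in> topspace (subtopology B U). (\<lambda>z. s (\<phi> z) u) \<in> V}" using N(2) by blast
      qed
    qed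
    show "openin ?W ((\<lambda>u z. s (\<phi> z) u) ` U)"
      unfolding openin_fibre_surjection_space
    proof (intro conjI ballI allI impI)
      show "(\<lambda>u z. s (\<phi> z) u) ` U \<subseteq> ?S" using T(1) by blast
      fix \<psi> U' s' assume "\<psi> \<in> (\<lambda>u z. s (\<phi> z) u) ` U" and U': "sections_over X p B U' s' \<and> fibre_proj p \<psi> \<in> U'"
      then obtain u where u: "u \<in> U" "\<psi> = (\<lambda>z. s (\<phi> z) u)" by blast
      have q\<psi>: "fibre_proj p \<psi> = u" using T(2)[OF u(1)] u(2) by simp
      have "openin B (U \<inter> U')" "u \<in> U \<inter> U'" 
        using UB sections_over_openin[of X p B U' s'] U' u q\<psi> by auto
      then obtain N where N: "openin B N" "path_connectedin B N" "u \<in> N" "N \<subseteq> U \<inter> U'"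
        using B unfolding locally_path_connected_space by metis
      have "s' (\<psi> z) v = s (\<phi> z) v" if v: "v \<in> N" for z v
      proof -
        have "s' (\<psi> z) v = s (\<psi> z) v"
          using sections_over_agree[OF p _ s N(1) path_connectedin_imp_connectedin[OF N(2)], of U' s' "\<psi> z" v]
            U' N D(2,6)[OF u(1)] u(2) v by auto
        then show ?thesis using D(5)[OF u(1)] v N(4) u(2) by auto
      qed
      then show "\<exists>N. openin B N \<and> fibre_proj p \<psi> \<in> N \<and> N \<subseteq> U' \<and>
          (\<forall>v\<in>N. (\<lambda>z. s' (\<psi> z) v) \<in> (\<lambda>u z. s (\<phi> z) u) ` U)"
        using N q\<psi> by (intro exI[of _ N]) auto
    qed
  qed
  then show "\<exists>U s. b \<in> U \<and> sections_over ?W (fibre_proj p) B U s" using U by (intro exI conjI)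
qed

lemma continuous_map_fibre_eval:
  assumes p: "covering_map X p B"
  shows "continuous_map (fibre_surjection_space X p B) X (\<lambda>\<phi>. \<phi> z)"
  unfolding continuous_map_def
proof (intro conjI allI impI)
  let ?W = "fibre_surjection_space X p B"
  show "(\<lambda>\<phi>. \<phi> z) \<in> topspace ?W \<rightarrow> topspace X" by (auto simp: fibre_surjections_def)
  fix O' assume O': "openin X O'"
  show "openin ?W {\<phi> \<in> topspace ?W. \<phi> z \<in> O'}"
    unfolding openin_fibre_surjection_space
  proof (intro conjI ballI allI impI)
    fix \<phi> U s assume "\<phi> \<in> {\<phi> \<in> topspace ?W. \<phi> z \<in> O'}" and U: "sections_over X p B U s \<and> fibre_proj p \<phi> \<in> U"
    then have \<phi>: "\<phi> \<in> fibre_surjections X p B" "\<phi> z \<in> O'" and s: "sections_over X p B U s"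
      and qU: "fibre_proj p \<phi> \<in> U" by auto
    note T = fibre_surjection_transport[OF s \<phi>(1) qU]
    have z: "\<phi> z \<in> topspace X" "p (\<phi> z) \<in> U" using T(3,4) qU by auto
    note D = sections_overD[OF s z]
    define N where "N = {u \<in> topspace (subtopology B U). s (\<phi> z) u \<in> O'}"
    have "openin (subtopology B U) N" unfolding N_def by (rule openin_continuous_map_preimage[OF D(1) O'])
    then have "openin B N" "N \<subseteq> U" by (simp_all add: openin_open_subtopology sections_over_openin[OF s])
    moreover have "fibre_proj p \<phi> \<in> N"
      using D(3) T(4) \<phi> qU fibre_surjectionD(2) by (simp add: N_def)
    moreover have "(\<lambda>z. s (\<phi> z) u) \<in> {\<phi> \<in> topspace ?W. \<phi> z \<in> O'}" if "u \<in> N" for u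
      using that T(1)[of u] by (simp add: N_def)
    ultimately show "\<exists>N. openin B N \<and> fibre_proj p \<phi> \<in> N \<and> N \<subseteq> U \<and>
        (\<forall>u\<in>N. (\<lambda>z. s (\<phi> z) u) \<in> {\<phi> \<in> topspace ?W. \<phi> z \<in> O'})" by blast
  qed auto
qed

text \<open>The argument of the introduction: \<open>X\<close> covers a component of the space of fibre surjections, and
  evaluation turns this covering into enough morphisms from \<open>X\<close> to itself.\<close>

lemma universal_cover_regular:
  fixes M :: "'a metric"
  assumes B: "locally_path_connected_space (mtopology_of M)"
    and X: "universal_cover TYPE('a path_set) M X p"
  shows "regular_covering_space_of M X p"
proof (rule regular_covering_space_ofI)
  let ?B = "mtopology_of M"
  show cov: "covering_space_of M X p" using X by (simp add: universal_cover_def)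
  then have C: "connected_space X" and p: "covering_map X p ?B" by (auto simp: covering_space_of_def)
  fix x y assume xy: "x \<in> topspace X" "y \<in> topspace X" "p x = p y"
  let ?W = "fibre_surjection_space X p ?B"
  have "connectedin ?B (p ` topspace X)"
    using connectedin_continuous_map_image[OF covering_mapD(1)[OF p]] C by (simp add: connectedin_topspace)
  then have CB: "connected_space ?B" using covering_mapD(2)[OF p] by (metis connectedin_topspace)
  have q: "covering_map ?W (fibre_proj p) ?B" by (rule covering_map_fibre_proj[OF B p])
  have "p x \<in> fibre_proj p ` topspace ?W"
    using covering_mapD(2)[OF q] covering_mapD(3)[OF p xy(1)] by simp
  then obtain \<phi> where \<phi>: "\<phi> \<in> topspace ?W" by blast
  define Y where "Y = subtopology ?W (connected_component_of_set ?W \<phi>)"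
  have qY: "covering_map Y (fibre_proj p) ?B"
    unfolding Y_def by (rule covering_map_connected_component[OF B CB q \<phi>])
  have "connected_space Y"
    unfolding Y_def using connectedin_connected_component_of[of ?W \<phi>] by (simp add: connectedin_def)
  then have covY: "covering_space_of M Y (fibre_proj p)" using qY by (simp add: covering_space_of_def)
  obtain Y' :: "'a path_set topology" and i j where h: "homeomorphic_maps Y Y' i j"
    and Y': "covering_space_of M Y' (fibre_proj p \<circ> j)"
    by (rule covering_space_copy_path_set[OF B covY])
  \<comment> \<open>Universality of \<open>X\<close> applies to the copy \<open>Y'\<close>; the homeomorphism \<open>j\<close> leads back to \<open>Y\<close>.\<close>
  then have "covers X p Y' (fibre_proj p \<circ> j)" using X by (simp add: universal_cover_def)
  then obtain f where f: "covering_map X f Y'" "\<And>x. x \<in> topspace X \<Longrightarrow> fibre_proj p (j (f x)) = p x"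
    by (auto simp: covers_def)
  have jf: "continuous_map X ?W (j \<circ> f)"
    using continuous_map_compose[OF covering_mapD(1)[OF f(1)]] h
    unfolding homeomorphic_maps_def Y_def by (metis continuous_map_in_subtopology)
  then have jfW: "j (f x) \<in> fibre_surjections X p ?B" if "x \<in> topspace X" for x
    using that by (auto simp: continuous_map_def)
  have "y \<in> range (j (f x))"
    using fibre_surjectionD(1)[OF jfW[OF xy(1)]] f(2)[OF xy(1)] xy by simp
  then obtain z where z: "j (f x) z = y" by auto
  show "\<exists>e. continuous_map X X e \<and> (\<forall>z\<in>topspace X. p (e z) = p z) \<and> e x = y"
  proof (intro exI[of _ "\<lambda>w. j (f w) z"] conjI ballI)
    show "continuous_map X X (\<lambda>w. j (f w) z)"
      using continuous_map_compose[OF jf continuous_map_fibre_eval[OF p]] by (simp add: o_def)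
    show "p (j (f w) z) = p w" if "w \<in> topspace X" for w
      using fibre_surjectionD(1)[OF jfW[OF that]] f(2)[OF that] rangeI[of "j (f w)" z] by simp
  qed (rule z)
qed

section \<open>The slipping group is normal\<close>

lemma curve_length_cong:
  assumes "\<And>t. t \<in> {0..1} \<Longrightarrow> \<gamma> t = \<delta> t"
  shows "curve_length M \<gamma> = curve_length M \<delta>"
  unfolding curve_length_def
proof (rule SUP_cong[OF refl], clarify)
  fix n and t :: "nat \<Rightarrow> real" assume t: "t ` {..n} \<subseteq> {0..1}"
  have "\<gamma> (t i) = \<delta> (t i)" if "i \<le> n" for i using assms t that by (simp add: image_subset_iff)
  then show "(\<Sum>i<n. ereal (mdist M (\<gamma> (t i)) (\<gamma> (t (Suc i))))) =
      (\<Sum>i<n. ereal (mdist M (\<delta> (t i)) (\<delta> (t (Suc i)))))"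
    by (intro sum.cong) auto
qed

lemma curve_length_reverse_le: "curve_length M (\<lambda>t. \<gamma> (1 - t)) \<le> curve_length M \<gamma>"
  unfolding curve_length_def
proof (rule SUP_least, clarify)
  fix n and t :: "nat \<Rightarrow> real" assume t: "mono_on {..n} t" "t ` {..n} \<subseteq> {0..1}"
  \<comment> \<open>The reversed partition runs through the points \<open>1 - t n, \<dots>, 1 - t 0\<close>.\<close>
  define t' where "t' = (\<lambda>i. 1 - t (n - i))"
  define g where "g = (\<lambda>j. ereal (mdist M (\<gamma> (t' j)) (\<gamma> (t' (Suc j)))))"
  have "mono_on {..n} t'"
    unfolding t'_def using mono_onD[OF t(1)] by (intro mono_onI) simp
  moreover have "t' ` {..n} \<subseteq> {0..1}" using t(2) by (auto simp: t'_def image_subset_iff)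
  ultimately have t': "(n, t') \<in> {(n, t). mono_on {..n} t \<and> t ` {..n} \<subseteq> {0..1}}" by simp
  have "(\<Sum>i<n. ereal (mdist M (\<gamma> (1 - t i)) (\<gamma> (1 - t (Suc i))))) = (\<Sum>i<n. g (n - Suc i))"
  proof (rule sum.cong[OF refl])
    fix i assume "i \<in> {..<n}"
    then have "n - (n - Suc i) = Suc i" "n - Suc (n - Suc i) = i" by auto
    then show "ereal (mdist M (\<gamma> (1 - t i)) (\<gamma> (1 - t (Suc i)))) = g (n - Suc i)"
      by (simp add: g_def t'_def mdist_commute)
  qed
  also have "\<dots> = (\<Sum>i<n. g i)" by (rule sum.nat_diff_reindex)
  also have "\<dots> \<le> (SUP (n, t)\<in>{(n, t). mono_on {..n} t \<and> t ` {..n} \<subseteq> {0..1}}.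
      \<Sum>i<n. ereal (mdist M (\<gamma> (t i)) (\<gamma> (t (Suc i)))))"
    by (rule SUP_upper2[OF t']) (simp add: g_def)
  finally show "(\<Sum>i<n. ereal (mdist M (\<gamma> (1 - t i)) (\<gamma> (1 - t (Suc i))))) \<le>
      (SUP (n, t)\<in>{(n, t). mono_on {..n} t \<and> t ` {..n} \<subseteq> {0..1}}.
        \<Sum>i<n. ereal (mdist M (\<gamma> (t i)) (\<gamma> (t (Suc i)))))" .
qed

text \<open>Reversing a path from \<open>x\<close> to \<open>y\<close> gives one from \<open>y\<close> to \<open>x\<close> that is no longer. Applied twice, this is symmetry.\<close>

lemma lifted_dist_commute_le: "lifted_dist M X p y x \<le> lifted_dist M X p x y"
  unfolding lifted_dist_def
proof (rule INF_greatest)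
  fix \<gamma> assume "\<gamma> \<in> {\<gamma>. pathin X \<gamma> \<and> \<gamma> 0 = x \<and> \<gamma> 1 = y}"
  then have \<gamma>: "pathin X \<gamma>" "\<gamma> 0 = x" "\<gamma> 1 = y" by auto
  have "continuous_map (top_of_set {0..1}) (top_of_set {0..1::real}) (\<lambda>t. 1 - t)"
    by (auto intro!: continuous_intros)
  then have "pathin X (\<lambda>t. \<gamma> (1 - t))"
    using \<gamma>(1) continuous_map_compose[of _ "top_of_set {0..1::real}" "\<lambda>t. 1 - t" X \<gamma>]
    by (simp add: pathin_def o_def)
  then have mem: "(\<lambda>t. \<gamma> (1 - t)) \<in> {\<gamma>. pathin X \<gamma> \<and> \<gamma> 0 = y \<and> \<gamma> 1 = x}" using \<gamma> by simp
  show "(INF \<gamma>\<in>{\<gamma>. pathin X \<gamma> \<and> \<gamma> 0 = y \<and> \<gamma> 1 = x}. curve_length M (p \<circ> \<gamma>)) \<le> curve_length M (p \<circ> \<gamma>)"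
    by (rule INF_lower2[OF mem]) (use curve_length_reverse_le[of M "p \<circ> \<gamma>"] in \<open>simp add: o_def\<close>)
qed

lemma lifted_dist_deck_le:
  assumes "h \<in> deck_transformations X p"
  shows "lifted_dist M X p (h x) (h y) \<le> lifted_dist M X p x y"
  unfolding lifted_dist_def
proof (rule INF_greatest)
  note D = deck_transformationsD[OF assms]
  fix \<gamma> assume "\<gamma> \<in> {\<gamma>. pathin X \<gamma> \<and> \<gamma> 0 = x \<and> \<gamma> 1 = y}"
  then have \<gamma>: "pathin X \<gamma>" "\<gamma> 0 = x" "\<gamma> 1 = y" by auto
  have mem: "h \<circ> \<gamma> \<in> {\<gamma>. pathin X \<gamma> \<and> \<gamma> 0 = h x \<and> \<gamma> 1 = h y}"
    using \<gamma> D(2) by (auto intro: pathin_compose)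
  have "\<gamma> t \<in> topspace X" if "t \<in> {0..1}" for t
    using \<gamma>(1) that by (auto simp: pathin_def continuous_map_def)
  then have "curve_length M (p \<circ> (h \<circ> \<gamma>)) = curve_length M (p \<circ> \<gamma>)"
    using D(4) by (intro curve_length_cong) simp
  then show "(INF \<gamma>\<in>{\<gamma>. pathin X \<gamma> \<and> \<gamma> 0 = h x \<and> \<gamma> 1 = h y}. curve_length M (p \<circ> \<gamma>)) \<le> curve_length M (p \<circ> \<gamma>)"
    by (intro INF_lower2[OF mem]) simp
qed

text \<open>The displacement of the conjugate at \<open>h x\<close> is at most the displacement of \<open>g\<close> at \<open>x\<close>.\<close>

lemma deck_length_conj_le:
  assumes g: "g \<in> deck_transformations X p" and h: "h \<in> deck_transformations X p"
  shows "deck_length M X p (h \<otimes>\<^bsub>deck_group X p\<^esub> g \<otimes>\<^bsub>deck_group X p\<^esub> inv\<^bsub>deck_group X p\<^esub> h)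
    \<le> deck_length M X p g"
  unfolding deck_length_def
proof (rule INF_greatest)
  let ?G = "deck_group X p"
  interpret G: group ?G by (rule group_deck_group)
  fix x assume x: "x \<in> topspace X"
  note D = deck_transformationsD[OF g] and E = deck_transformationsD[OF h]
  note i = deck_group_inv_apply[OF h]
  have hg: "h \<otimes>\<^bsub>?G\<^esub> g \<in> deck_transformations X p"
    using G.m_closed[of h g] g h by (simp add: carrier_deck_group)
  have "(h \<otimes>\<^bsub>?G\<^esub> g \<otimes>\<^bsub>?G\<^esub> inv\<^bsub>?G\<^esub> h) (h x) = h (g x)"
    using deck_group_mult_apply[OF hg i(1)[OF x] E(5)[OF x]] deck_group_mult_apply[OF h g x] i(3)[OF x] by simp
  then show "(INF x\<in>topspace X. lifted_dist M X p ((h \<otimes>\<^bsub>?G\<^esub> g \<otimes>\<^bsub>?G\<^esub> inv\<^bsub>?G\<^esub> h) x) x) \<le> lifted_dist M X p (g x) x"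
    using lifted_dist_deck_le[OF h, of M "g x" x] by (intro INF_lower2[OF E(5)[OF x]]) simp
qed

text \<open>The displacement of the inverse at \<open>g x\<close> is at most that of \<open>g\<close> at \<open>x\<close>, by reversing paths.\<close>

lemma deck_length_inv_le:
  assumes g: "g \<in> deck_transformations X p"
  shows "deck_length M X p (inv\<^bsub>deck_group X p\<^esub> g) \<le> deck_length M X p g"
  unfolding deck_length_def
proof (rule INF_greatest)
  fix x assume x: "x \<in> topspace X"
  show "(INF x\<in>topspace X. lifted_dist M X p ((inv\<^bsub>deck_group X p\<^esub> g) x) x) \<le> lifted_dist M X p (g x) x"
    using lifted_dist_commute_le[of M X p x "g x"] deck_group_inv_apply(3)[OF g x]
    by (intro INF_lower2[OF deck_transformationsD(5)[OF g x]]) simp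
qed

lemma normal_delta_group: "delta_group M X p \<delta> \<lhd> deck_group X p"
proof -
  interpret G: group "deck_group X p" by (rule group_deck_group)
  show ?thesis
    unfolding delta_group_def
  proof (rule G.normal_generateI)
    fix h g
    assume h: "h \<in> {g \<in> carrier (deck_group X p). deck_length M X p g < ereal (2 * \<delta>)}"
      and g: "g \<in> carrier (deck_group X p)"
    then show "g \<otimes>\<^bsub>deck_group X p\<^esub> h \<otimes>\<^bsub>deck_group X p\<^esub> inv\<^bsub>deck_group X p\<^esub> g
        \<in> {g \<in> carrier (deck_group X p). deck_length M X p g < ereal (2 * \<delta>)}"
      using deck_length_conj_le[of h X p g M] by (auto simp: carrier_deck_group[symmetric])
  qed auto
qed

lemma (in group) generate_eq_products:
  assumes S: "S \<subseteq> carrier G" "\<And>s. s \<in> S \<Longrightarrow> inv s \<in> S"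
  shows "generate G S = {foldr (\<otimes>) gs \<one> |gs. set gs \<subseteq> S}"
proof (intro equalityI subsetI)
  fix g assume "g \<in> generate G S"
  then show "g \<in> {foldr (\<otimes>) gs \<one> |gs. set gs \<subseteq> S}"
  proof induction
    case one
    show ?case by (auto intro!: exI[of _ "[]"])
  next
    case (incl h)
    then show ?case using S by (auto intro!: exI[of _ "[h]"])
  next
    case (inv h)
    then show ?case using S by (auto intro!: exI[of _ "[inv h]"])
  next
    case (eng h1 h2)
    then obtain as bs where as: "h1 = foldr (\<otimes>) as \<one>" "set as \<subseteq> S" and bs: "h2 = foldr (\<otimes>) bs \<one>" "set bs \<subseteq> S"
      by auto
    have closed: "foldr (\<otimes>) xs \<one> \<in> carrier G" if "set xs \<subseteq> S" for xs
      using that S(1) by (induction xs) auto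
    have "foldr (\<otimes>) (as @ bs) \<one> = h1 \<otimes> h2"
      unfolding as(1) using as(2)
    proof (induction as)
      case Nil
      then show ?case using closed[OF bs(2)] bs(1) by simp
    next
      case (Cons a as)
      then show ?case using S(1) closed bs by (auto simp: m_assoc)
    qed
    then show ?case using as(2) bs(2) by (auto intro!: exI[of _ "as @ bs"])
  qed
next
  fix g assume "g \<in> {foldr (\<otimes>) gs \<one> |gs. set gs \<subseteq> S}"
  then obtain gs where "g = foldr (\<otimes>) gs \<one>" "set gs \<subseteq> S" by blast
  then show "g \<in> generate G S"
    by (induction gs arbitrary: g) (auto intro: generate.one generate.eng generate.incl)
qed

text \<open>The bound \<open>2 * \<delta>\<close> in the definition of the delta group and the bound \<open>\<delta>\<close> in that of the slipping
  group both range over all positive numbers, so the factor is absorbed by halving \<open>\<delta>\<close>.\<close>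

lemma slipping_group_eq_Inter: "slipping_group M X p = (\<Inter>\<delta>\<in>{0<..}. delta_group M X p \<delta>)"
proof -
  let ?G = "deck_group X p"
  interpret G: group ?G by (rule group_deck_group)
  define S where "S = (\<lambda>\<delta>::real. {g \<in> carrier ?G. deck_length M X p g < ereal (2 * \<delta>)})"
  have gen: "generate ?G (S \<delta>) = {foldr (\<otimes>\<^bsub>?G\<^esub>) gs \<one>\<^bsub>?G\<^esub> |gs. set gs \<subseteq> S \<delta>}" for \<delta>
  proof (rule G.generate_eq_products)
    show "inv\<^bsub>?G\<^esub> s \<in> S \<delta>" if "s \<in> S \<delta>" for s
      using that deck_length_inv_le[of s X p M] by (auto simp: S_def carrier_deck_group[symmetric])
  qed (auto simp: S_def)
  have mem: "g \<in> delta_group M X p \<delta> \<longleftrightarrow> (\<exists>gs. set gs \<subseteq> carrier ?G \<and>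
      (\<forall>h\<in>set gs. deck_length M X p h < ereal (2 * \<delta>)) \<and> g = foldr (\<otimes>\<^bsub>?G\<^esub>) gs \<one>\<^bsub>?G\<^esub>)" for g \<delta>
    unfolding delta_group_def gen[unfolded S_def] by auto
  show ?thesis
  proof (intro equalityI subsetI INT_I)
    fix g and \<delta> :: real assume "g \<in> slipping_group M X p" "\<delta> \<in> {0<..}"
    moreover from this have "2 * \<delta> > 0" by simp
    ultimately show "g \<in> delta_group M X p \<delta>"
      unfolding mem slipping_group_def by blast
  next
    fix g assume g: "g \<in> (\<Inter>\<delta>\<in>{0<..}. delta_group M X p \<delta>)"
    then have "g \<in> delta_group M X p 1" by simp
    then have "g \<in> carrier ?G"
      using subgroup.subset[OF normal_imp_subgroup[OF normal_delta_group]] by blast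
    moreover have "\<exists>gs. set gs \<subseteq> carrier ?G \<and>
      (\<forall>h\<in>set gs. deck_length M X p h < ereal \<delta>) \<and> g = foldr (\<otimes>\<^bsub>?G\<^esub>) gs \<one>\<^bsub>?G\<^esub>" if "\<delta> > 0" for \<delta>
    proof -
      have "g \<in> delta_group M X p (\<delta> / 2)" using g that by simp
      then show ?thesis unfolding mem by simp
    qed
    ultimately show "g \<in> slipping_group M X p" by (simp add: slipping_group_def)
  qed
qed

lemma normal_slipping_group: "slipping_group M X p \<lhd> deck_group X p"
proof -
  interpret G: group "deck_group X p" by (rule group_deck_group)
  have "subgroup (\<Inter>(delta_group M X p ` {0<..})) (deck_group X p)"
  proof (rule G.subgroups_Inter)
    have "(1::real) \<in> {0<..}" by simp
    then show "delta_group M X p ` {0<..} \<noteq> {}" by blast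
  qed (use normal_imp_subgroup[OF normal_delta_group] in blast)
  moreover have "x \<otimes>\<^bsub>deck_group X p\<^esub> h \<otimes>\<^bsub>deck_group X p\<^esub> inv\<^bsub>deck_group X p\<^esub> x \<in> delta_group M X p \<delta>"
    if "x \<in> carrier (deck_group X p)" "h \<in> delta_group M X p \<delta>" for x h \<delta>
    using normal.inv_op_closed2[OF normal_delta_group that] .
  ultimately show ?thesis
    unfolding G.normal_inv_iff slipping_group_eq_Inter by simp
qed

section \<open>The universal delta cover\<close>

lemma covers_orbit_spaces:
  assumes B: "locally_path_connected_space B" and p: "covering_map X p B"
    and H: "subgroup H (deck_group X p)" and K: "subgroup K (deck_group X p)" and "H \<subseteq> K"
  shows "covers (orbit_space X H) (orbit_proj p) (orbit_space X K) (orbit_proj p)"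
proof -
  interpret H: deck_subgroup X p H by (rule deck_subgroup.intro[OF H])
  interpret K: deck_subgroup X p K by (rule deck_subgroup.intro[OF K])
  define f where "f = (\<lambda>C. \<Union>x\<in>C. orbit_of K x)"
  have f: "f (orbit_of H x) = orbit_of K x" if x: "x \<in> topspace X" for x
  proof -
    have "orbit_of K y = orbit_of K x" if "y \<in> orbit_of H x" for y
      using that K.orbit_of_act[OF x] \<open>H \<subseteq> K\<close> by (auto simp: orbit_of_def[of H])
    then have "f (orbit_of H x) = (\<Union>y\<in>orbit_of H x. orbit_of K x)"
      unfolding f_def by (rule SUP_cong[OF refl])
    then show ?thesis using H.orbit_of_refl[OF x] by auto
  qed
  have "continuous_map X (orbit_space X K) (f \<circ> orbit_of H)"
    by (rule continuous_map_eq[OF continuous_map_orbit_of]) (simp add: f)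
  then have "continuous_map (orbit_space X H) (orbit_space X K) f"
    by (rule continuous_map_from_orbit_space)
  moreover have "f ` topspace (orbit_space X H) = topspace (orbit_space X K)"
    by (simp add: image_image f)
  moreover have over: "orbit_proj p (f C) = orbit_proj p C" if "C \<in> topspace (orbit_space X H)" for C
    using that by (auto simp: f H.orbit_proj_orbit_of K.orbit_proj_orbit_of)
  ultimately have "covering_map (orbit_space X H) f (orbit_space X K)"
    by (rule covering_map_over[OF B H.covering_map_orbit_proj[OF B p] K.covering_map_orbit_proj[OF B p]])
  with over show ?thesis unfolding covers_def by blast
qed

lemma open_map_covering_map:
  assumes "covering_map X p B"
  shows "open_map X B p"
  unfolding open_map_def
proof (intro allI impI)
  fix V assume V: "openin X V"
  show "openin B (p ` V)"
  proof (subst openin_subopen, intro ballI)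
    fix b assume "b \<in> p ` V"
    then obtain x where x: "x \<in> V" "b = p x" by blast
    have xX: "x \<in> topspace X" using x(1) openin_subset[OF V] by blast
    obtain U s where U: "p x \<in> U" and s: "sections_over X p B U s"
      by (rule covering_map_sectionsE[OF assms covering_mapD(3)[OF assms xX]])
    note D = sections_overD[OF s xX U]
    define N where "N = {u \<in> topspace (subtopology B U). s x u \<in> V}"
    have "openin (subtopology B U) N" unfolding N_def by (rule openin_continuous_map_preimage[OF D(1) V])
    then have N: "openin B N" "N \<subseteq> U" by (simp_all add: openin_open_subtopology sections_over_openin[OF s])
    have "b \<in> N" using D(3) x U covering_mapD(3)[OF assms xX] by (simp add: N_def)
    moreover have "u \<in> p ` V" if u: "u \<in> N" for u
    proof -
      have "p (s x u) = u" "s x u \<in> V" using u N(2) D(2) by (auto simp: N_def)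
      then show ?thesis by force
    qed
    ultimately show "\<exists>T. openin B T \<and> b \<in> T \<and> T \<subseteq> p ` V" using N(1) by auto
  qed
qed

lemma deck_transformation_eqI:
  assumes p: "covering_map X p B" and C: "connected_space X"
    and g: "g \<in> deck_transformations X p" and h: "h \<in> deck_transformations X p"
    and x: "x \<in> topspace X" "g x = h x"
  shows "g = h"
proof (rule extensionalityI[of g "topspace X"])
  note D = deck_transformationsD[OF g] and E = deck_transformationsD[OF h]
  show "g \<in> extensional (topspace X)" "h \<in> extensional (topspace X)"
    using D(1) E(1) Bij_imp_extensional by blast+
  show "g z = h z" if "z \<in> topspace X" for z
    using unique_lifting[OF p C D(2) E(2) _ x that] D(4) E(4) by simp
qed

text \<open>The heart of the universal property. The covering \<open>f\<close> of \<open>Y\<close> by \<open>X\<close> is an open surjection, so it is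
  enough to show that points with the same image under \<open>f\<close> have the same orbit under the slipping
  group. The deck transformation relating two such points is caught in each delta group in turn.\<close>

lemma covers_slipping_quotient:
  fixes M :: "'a metric" and Y :: "'c topology"
  assumes B: "locally_path_connected_space (mtopology_of M)"
    and X: "universal_cover TYPE('a path_set) M X p"
    and Y: "covering_space_of M Y q" and \<delta>: "covers_delta_covers M X p Y q"
  shows "covers Y q (orbit_space X (slipping_group M X p)) (orbit_proj p)"
proof -
  let ?B = "mtopology_of M" and ?H = "slipping_group M X p" and ?G = "deck_group X p"
  let ?Z = "orbit_space X ?H"
  interpret G: group ?G by (rule group_deck_group)
  interpret H: deck_subgroup X p ?H
    by (rule deck_subgroup.intro[OF normal_imp_subgroup[OF normal_slipping_group]])
  have reg: "regular_covering_space_of M X p" by (rule universal_cover_regular[OF B X])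
  then have C: "connected_space X" and p: "covering_map X p ?B"
    by (auto simp: regular_covering_space_of_def covering_space_of_def)
  have q: "covering_map Y q ?B" using Y by (simp add: covering_space_of_def)
  obtain Y' :: "'a path_set topology" and i j where ij: "homeomorphic_maps Y Y' i j"
    and Y': "covering_space_of M Y' (q \<circ> j)"
    by (rule covering_space_copy_path_set[OF B Y])
  then have "covers X p Y' (q \<circ> j)" using X by (simp add: universal_cover_def)
  then obtain f' where f': "covering_map X f' Y'" "\<And>x. x \<in> topspace X \<Longrightarrow> q (j (f' x)) = p x"
    by (auto simp: covers_def)
  define f where "f = j \<circ> f'"
  have jY: "j ` topspace Y' = topspace Y" "continuous_map Y' Y j"
    using ij homeomorphic_imp_surjective_map homeomorphic_maps_map homeomorphic_maps_def by metis+
  have f: "continuous_map X Y f" "f ` topspace X = topspace Y" "\<And>x. x \<in> topspace X \<Longrightarrow> q (f x) = p x"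
    using continuous_map_compose[OF covering_mapD(1)[OF f'(1)] jY(2)] covering_mapD(2)[OF f'(1)] jY(1) f'(2)
    by (simp_all add: f_def flip: image_image)
  have fY: "f x \<in> topspace Y" if "x \<in> topspace X" for x using f(2) that by blast
  \<comment> \<open>The fibres of \<open>f\<close> lie in orbits of the slipping group.\<close>
  have orbit_eq: "orbit_of ?H x = orbit_of ?H x'"
    if x: "x \<in> topspace X" "x' \<in> topspace X" and eq: "f x = f x'" for x x'
  proof -
    have "p x = p x'" using f(3) x eq by metis
    then obtain g where g: "g \<in> deck_transformations X p" and gx: "g x = x'"
      using reg x by (auto simp: regular_covering_space_of_def)
    have "g \<in> delta_group M X p d" if d: "d > 0" for d
    proof -
      let ?K = "delta_group M X p d"
      interpret K: deck_subgroup X p ?K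
        by (rule deck_subgroup.intro[OF normal_imp_subgroup[OF normal_delta_group]])
      have r: "covering_map (orbit_space X ?K) (orbit_proj p) ?B" by (rule K.covering_map_orbit_proj[OF B p])
      obtain k where k: "covering_map Y k (orbit_space X ?K)" "\<And>y. y \<in> topspace Y \<Longrightarrow> orbit_proj p (k y) = q y"
        using \<delta> d by (auto simp: covers_delta_covers_def covers_def)
      have "k (f x) \<in> orbit_of ?K ` topspace X" using covering_mapD(3)[OF k(1) fY[OF x(1)]] by simp
      then obtain w where w: "w \<in> topspace X" "k (f x) = orbit_of ?K w" by blast
      then have "p x = p w" using k(2)[OF fY[OF x(1)]] f(3)[OF x(1)] K.orbit_proj_orbit_of by simp
      then obtain h where h: "h \<in> deck_transformations X p" and hx: "h x = w"
        using reg x(1) w(1) by (auto simp: regular_covering_space_of_def)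
      note D = deck_transformationsD[OF h]
      \<comment> \<open>Two lifts of \<open>p\<close> to the delta cover that agree at \<open>x\<close>.\<close>
      have kf: "(k \<circ> f) z = (orbit_of ?K \<circ> h) z" if "z \<in> topspace X" for z
      proof (rule unique_lifting[OF r C _ _ _ x(1) _ that])
        show "continuous_map X (orbit_space X ?K) (k \<circ> f)"
          by (rule continuous_map_compose[OF f(1) covering_mapD(1)[OF k(1)]])
        show "continuous_map X (orbit_space X ?K) (orbit_of ?K \<circ> h)"
          by (rule continuous_map_compose[OF D(2) continuous_map_orbit_of])
        show "orbit_proj p ((k \<circ> f) c) = orbit_proj p ((orbit_of ?K \<circ> h) c)" if "c \<in> topspace X" for c
          using k(2)[OF fY[OF that]] f(3)[OF that] K.orbit_proj_orbit_of[OF D(5)[OF that]] D(4)[OF that] by simp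
        show "(k \<circ> f) x = (orbit_of ?K \<circ> h) x" using w(2) hx by simp
      qed
      have "orbit_of ?K (h x) = orbit_of ?K (h x')" using kf[OF x(1)] kf[OF x(2)] eq by simp
      then obtain c where c: "c \<in> ?K" "h x' = c (h x)"
        using K.orbit_of_eq_iff[OF D(5) D(5)] x by auto
      have cG: "c \<in> carrier ?G" and hG: "h \<in> carrier ?G" and gG: "g \<in> carrier ?G"
        using K.deck[OF c(1)] h g by (simp_all add: carrier_deck_group)
      \<comment> \<open>Both sides send \<open>x\<close> to \<open>h x'\<close>, so \<open>g\<close> is the conjugate of \<open>c\<close> by the inverse of \<open>h\<close>.\<close>
      have "h \<otimes>\<^bsub>?G\<^esub> g = c \<otimes>\<^bsub>?G\<^esub> h"
      proof (rule deck_transformation_eqI[OF p C _ _ x(1)])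
        show "(h \<otimes>\<^bsub>?G\<^esub> g) x = (c \<otimes>\<^bsub>?G\<^esub> h) x"
          using deck_group_mult_apply[OF h g x(1)] deck_group_mult_apply[OF K.deck[OF c(1)] h x(1)] c(2) gx by simp
      qed (use G.m_closed[OF hG gG] G.m_closed[OF cG hG] in \<open>simp_all add: carrier_deck_group\<close>)
      then have "g = inv\<^bsub>?G\<^esub> h \<otimes>\<^bsub>?G\<^esub> (c \<otimes>\<^bsub>?G\<^esub> h)"
        using G.inv_solve_left[OF gG hG] cG hG by simp
      then show "g \<in> ?K"
        using normal.inv_op_closed1[OF normal_delta_group hG c(1)] cG hG by (simp add: G.m_assoc)
    qed
    then have "g \<in> ?H" by (simp add: slipping_group_eq_Inter)
    then show ?thesis using H.orbit_of_act[OF x(1)] gx by metis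
  qed
  define k where "k = (\<lambda>y. orbit_of ?H (SOME x. x \<in> topspace X \<and> f x = y))"
  have k: "k (f x) = orbit_of ?H x" if x: "x \<in> topspace X" for x
  proof -
    have "(SOME x'. x' \<in> topspace X \<and> f x' = f x) \<in> topspace X \<and> f (SOME x'. x' \<in> topspace X \<and> f x' = f x) = f x"
      by (rule someI[of _ x]) (simp add: x)
    then show ?thesis unfolding k_def using orbit_eq x by metis
  qed
  have k': "\<exists>x\<in>topspace X. y = f x \<and> k y = orbit_of ?H x" if "y \<in> topspace Y" for y
    using that k f(2) by (metis imageE)
  have f_open: "open_map X Y f" by (rule open_map_covering_map[OF covering_map_over[OF B p q f]])
  have "continuous_map Y ?Z k"
    unfolding continuous_map_def
  proof (intro conjI allI impI)
    show "k \<in> topspace Y \<rightarrow> topspace ?Z" using k' by force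
    fix V assume "openin ?Z V"
    then have "openin X {x \<in> topspace X. orbit_of ?H x \<in> V}" by (simp add: openin_orbit_space)
    then have "openin Y (f ` {x \<in> topspace X. orbit_of ?H x \<in> V})" using f_open by (simp add: open_map_def)
    moreover have "f ` {x \<in> topspace X. orbit_of ?H x \<in> V} = {y \<in> topspace Y. k y \<in> V}"
      using k k' fY by force
    ultimately show "openin Y {y \<in> topspace Y. k y \<in> V}" by simp
  qed
  moreover have "k ` topspace Y = topspace ?Z"
    using k by (simp add: f(2)[symmetric] image_image)
  moreover have over: "orbit_proj p (k y) = q y" if y: "y \<in> topspace Y" for y
    using k'[OF y] f(3) H.orbit_proj_orbit_of by auto
  ultimately have "covering_map Y k ?Z"
    by (rule covering_map_over[OF B q H.covering_map_orbit_proj[OF B p]])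
  with over show ?thesis unfolding covers_def by blast
qed

lemma universal_delta_cover_slipping_quotient:
  fixes M :: "'a metric"
  assumes B: "locally_path_connected_space (mtopology_of M)"
    and X: "universal_cover TYPE('a path_set) M X p"
  shows "universal_delta_cover TYPE('c) M X p (orbit_space X (slipping_group M X p)) (orbit_proj p)"
    and "regular_covering_space_of M (orbit_space X (slipping_group M X p)) (orbit_proj p)"
proof -
  let ?Z = "orbit_space X (slipping_group M X p)"
  have reg: "regular_covering_space_of M X p" by (rule universal_cover_regular[OF B X])
  then have p: "covering_map X p (mtopology_of M)"
    by (simp add: regular_covering_space_of_def covering_space_of_def)
  show regZ: "regular_covering_space_of M ?Z (orbit_proj p)"
    by (rule regular_covering_orbit_space[OF B reg normal_slipping_group])
  have "covers_delta_covers M X p ?Z (orbit_proj p)"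
    unfolding covers_delta_covers_def
  proof (intro allI impI)
    fix d :: real assume "d > 0"
    then have "slipping_group M X p \<subseteq> delta_group M X p d" by (auto simp: slipping_group_eq_Inter)
    then show "covers ?Z (orbit_proj p) (delta_cover M X p d) (orbit_proj p)"
      by (rule covers_orbit_spaces[OF B p normal_imp_subgroup[OF normal_slipping_group]
            normal_imp_subgroup[OF normal_delta_group]])
  qed
  with regZ show "universal_delta_cover TYPE('c) M X p ?Z (orbit_proj p)"
    unfolding universal_delta_cover_def
    by (intro conjI allI impI covers_slipping_quotient[OF B X]) (simp_all add: regular_covering_space_of_def)
qed

lemma covers_homeomorphic:
  assumes B: "locally_path_connected_space B" and q: "covering_map Y q B" and r: "covering_map W r B"
    and ij: "homeomorphic_maps Y Y' i j" and cov: "covers Y q W r"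
  shows "covers Y' (q \<circ> j) W r"
proof -
  obtain f where f: "covering_map Y f W" "\<And>y. y \<in> topspace Y \<Longrightarrow> r (f y) = q y"
    using cov by (auto simp: covers_def)
  have j: "continuous_map Y' Y j" "j ` topspace Y' = topspace Y"
    using ij homeomorphic_imp_surjective_map homeomorphic_maps_map homeomorphic_maps_def by metis+
  have over: "r ((f \<circ> j) y) = (q \<circ> j) y" if "y \<in> topspace Y'" for y
    using f(2) j(2) that by auto
  have "covering_map Y' (f \<circ> j) W"
  proof (rule covering_map_over[OF B covering_map_homeomorphic[OF q ij] r _ _ over])
    show "continuous_map Y' W (f \<circ> j)" by (rule continuous_map_compose[OF j(1) covering_mapD(1)[OF f(1)]])
    show "(f \<circ> j) ` topspace Y' = topspace W"
      using j(2) covering_mapD(2)[OF f(1)] by (simp flip: image_image)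
  qed
  with over show ?thesis unfolding covers_def by blast
qed

text \<open>The composite of the two coverings is a morphism of \<open>Z\<close>; by regularity some deck transformation
  \<open>d\<close> undoes it at one point, hence everywhere by unique lifting. So \<open>d \<circ> h\<close> is inverse to \<open>f\<close>.\<close>

lemma mutual_covers_imp_homeomorphic:
  assumes B: "locally_path_connected_space (mtopology_of M)" and Z: "regular_covering_space_of M Z r"
    and Y: "covering_space_of M Y q"
    and ZY: "covers Z r Y q" and YZ: "covers Y q Z r"
  obtains f h where "homeomorphic_maps Z Y f h" "\<forall>z\<in>topspace Z. q (f z) = r z"
proof -
  have CZ: "connected_space Z" and r: "covering_map Z r (mtopology_of M)"
    using Z by (auto simp: regular_covering_space_of_def covering_space_of_def)
  obtain f where f: "covering_map Z f Y" "\<And>z. z \<in> topspace Z \<Longrightarrow> q (f z) = r z"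
    using ZY by (auto simp: covers_def)
  obtain h where h: "covering_map Y h Z" "\<And>y. y \<in> topspace Y \<Longrightarrow> r (h y) = q y"
    using YZ by (auto simp: covers_def)
  have fY: "f z \<in> topspace Y" if "z \<in> topspace Z" for z using covering_mapD(3)[OF f(1) that] .
  have hZ: "h y \<in> topspace Z" if "y \<in> topspace Y" for y using covering_mapD(3)[OF h(1) that] .
  have hf: "continuous_map Z Z (h \<circ> f)"
    by (rule continuous_map_compose[OF covering_mapD(1)[OF f(1)] covering_mapD(1)[OF h(1)]])
  have "\<exists>d. continuous_map Z Z d \<and> (\<forall>z\<in>topspace Z. d (h (f z)) = z)"
  proof (cases "topspace Z = {}")
    case True
    then show ?thesis by (intro exI[of _ id]) simp
  next
    case False
    then obtain z0 where z0: "z0 \<in> topspace Z" by blast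
    have "r (h (f z0)) = r z0" using f(2)[OF z0] h(2)[OF fY[OF z0]] by simp
    then obtain d where d: "d \<in> deck_transformations Z r" "d (h (f z0)) = z0"
      using Z hZ[OF fY[OF z0]] z0 unfolding regular_covering_space_of_def by blast
    note D = deck_transformationsD[OF d(1)]
    have "(d \<circ> (h \<circ> f)) z = id z" if "z \<in> topspace Z" for z
    proof (rule unique_lifting[OF r CZ continuous_map_compose[OF hf D(2)] continuous_map_id _ z0 _ that])
      show "r ((d \<circ> (h \<circ> f)) c) = r (id c)" if "c \<in> topspace Z" for c
        using D(4) hZ fY f(2) h(2) that by simp
    qed (use d(2) in simp)
    then show ?thesis using D(2) by (intro exI[of _ d]) simp
  qed
  then obtain d where d: "continuous_map Z Z d" "\<And>z. z \<in> topspace Z \<Longrightarrow> d (h (f z)) = z" by blast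
  have "f ((d \<circ> h) y) = y" if y: "y \<in> topspace Y" for y
  proof -
    obtain z where "z \<in> topspace Z" "y = f z" using y covering_mapD(2)[OF f(1)] by (metis imageE)
    then show ?thesis using d(2) by simp
  qed
  then have "homeomorphic_maps Z Y f (d \<circ> h)"
    unfolding homeomorphic_maps_def
    using covering_mapD(1)[OF f(1)] continuous_map_compose[OF covering_mapD(1)[OF h(1)] d(1)] d(2) by simp
  then show ?thesis by (rule that) (simp add: f(2))
qed

lemma regular_covering_homeomorphic:
  assumes Z: "regular_covering_space_of M Z r" and Y: "covering_space_of M Y q"
    and fh: "homeomorphic_maps Z Y f h" and over: "\<forall>z\<in>topspace Z. q (f z) = r z"
  shows "regular_covering_space_of M Y q"
proof (rule regular_covering_space_ofI[OF Y])
  have F: "continuous_map Z Y f" "continuous_map Y Z h" "\<And>y. y \<in> topspace Y \<Longrightarrow> f (h y) = y"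
    "\<And>y. y \<in> topspace Y \<Longrightarrow> h y \<in> topspace Z"
    using fh by (auto simp: homeomorphic_maps_def continuous_map_def)
  have rh: "r (h y) = q y" if "y \<in> topspace Y" for y using over F(4)[OF that] F(3)[OF that] by fastforce
  fix x y assume xy: "x \<in> topspace Y" "y \<in> topspace Y" "q x = q y"
  then have "r (h x) = r (h y)" using rh by simp
  then obtain g where g: "g \<in> deck_transformations Z r" "g (h x) = h y"
    using Z F(4)[OF xy(1)] F(4)[OF xy(2)] unfolding regular_covering_space_of_def by blast
  note D = deck_transformationsD[OF g(1)]
  show "\<exists>e. continuous_map Y Y e \<and> (\<forall>z\<in>topspace Y. q (e z) = q z) \<and> e x = y"
  proof (intro exI[of _ "f \<circ> (g \<circ> h)"] conjI ballI)
    show "continuous_map Y Y (f \<circ> (g \<circ> h))"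
      by (rule continuous_map_compose[OF continuous_map_compose[OF F(2) D(2)] F(1)])
    show "q ((f \<circ> (g \<circ> h)) z) = q z" if "z \<in> topspace Y" for z
      using over D(4,5) F(4) rh that by simp
    show "(f \<circ> (g \<circ> h)) x = y" using g(2) F(3) xy(2) by simp
  qed
qed

theorem theorem4p10:
  fixes M :: "'a metric" and X :: "'b topology" and p :: "'b \<Rightarrow> 'a"
  assumes "complete_length_space M"
    and "universal_cover TYPE('a path_set) M X p"
  shows "universal_delta_cover TYPE('c) M X p
           (orbit_space X (slipping_group M X p)) (orbit_proj p) \<and>
         regular_covering_space_of M
           (orbit_space X (slipping_group M X p)) (orbit_proj p) \<and>
         (\<forall>(M0::'d topology) p0.
            universal_delta_cover TYPE('a path_set) M X p M0 p0 \<longrightarrow>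
              isomorphic_covers M0 p0
                (orbit_space X (slipping_group M X p)) (orbit_proj p) \<and>
              regular_covering_space_of M M0 p0)"
proof (intro conjI allI impI)
  let ?Z = "orbit_space X (slipping_group M X p)" and ?r = "orbit_proj p :: 'b set \<Rightarrow> 'a"
  note B = locally_path_connected_length_space[OF assms(1)]
  note X = assms(2)
  show "universal_delta_cover TYPE('c) M X p ?Z ?r"
    by (rule universal_delta_cover_slipping_quotient(1)[OF B X])
  show regZ: "regular_covering_space_of M ?Z ?r"
    by (rule universal_delta_cover_slipping_quotient(2)[OF B X])
  then have covZ: "covering_space_of M ?Z ?r" and r: "covering_map ?Z ?r (mtopology_of M)"
    by (auto simp: regular_covering_space_of_def covering_space_of_def)
  have p: "covering_map X p (mtopology_of M)"
    using X by (simp add: universal_cover_def covering_space_of_def)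
  have Z: "covers_delta_covers M X p ?Z ?r"
    using universal_delta_cover_slipping_quotient(1)[OF B X, where ?'c = 'd] by (simp add: universal_delta_cover_def)
  fix M0 :: "'d topology" and p0
  assume M0: "universal_delta_cover TYPE('a path_set) M X p M0 p0"
  then have cov0: "covering_space_of M M0 p0" and cd0: "covers_delta_covers M X p M0 p0"
    by (auto simp: universal_delta_cover_def)
  have p0: "covering_map M0 p0 (mtopology_of M)" using cov0 by (simp add: covering_space_of_def)
  have M0Z: "covers M0 p0 ?Z ?r" by (rule covers_slipping_quotient[OF B X cov0 cd0])
  \<comment> \<open>The universal property of \<open>M0\<close> is applied to a copy of the orbit space in the right type.\<close>
  obtain Z' :: "'a path_set topology" and i j where ij: "homeomorphic_maps ?Z Z' i j"
    and Z': "covering_space_of M Z' (?r \<circ> j)"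
    by (rule covering_space_copy_path_set[OF B covZ])
  have "covers_delta_covers M X p Z' (?r \<circ> j)"
    unfolding covers_delta_covers_def
  proof (intro allI impI)
    fix d :: real assume d: "d > 0"
    interpret K: deck_subgroup X p "delta_group M X p d"
      by (rule deck_subgroup.intro[OF normal_imp_subgroup[OF normal_delta_group]])
    show "covers Z' (?r \<circ> j) (delta_cover M X p d) (orbit_proj p)"
      using covers_homeomorphic[OF B r K.covering_map_orbit_proj[OF B p] ij] Z d
      by (simp add: covers_delta_covers_def)
  qed
  then have cov': "covers Z' (?r \<circ> j) M0 p0" using M0 Z' by (simp add: universal_delta_cover_def)
  have q': "covering_map Z' (?r \<circ> j) (mtopology_of M)" using Z' by (simp add: covering_space_of_def)
  have ji: "homeomorphic_maps Z' ?Z j i" using ij homeomorphic_maps_sym by blast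
  have "covers ?Z ((?r \<circ> j) \<circ> i) M0 p0" by (rule covers_homeomorphic[OF B q' p0 ji cov'])
  moreover have "((?r \<circ> j) \<circ> i) z = ?r z" if "z \<in> topspace ?Z" for z
    using ij that by (simp add: homeomorphic_maps_def del: topspace_orbit_space)
  ultimately have ZM0: "covers ?Z ?r M0 p0" unfolding covers_def by auto
  obtain f h where fh: "homeomorphic_maps ?Z M0 f h" and over: "\<forall>z\<in>topspace ?Z. p0 (f z) = ?r z"
    by (rule mutual_covers_imp_homeomorphic[OF B regZ cov0 ZM0 M0Z])
  show "regular_covering_space_of M M0 p0"
    by (rule regular_covering_homeomorphic[OF regZ cov0 fh over])
  have "?r (h y) = p0 y" if y: "y \<in> topspace M0" for y
  proof -
    have "h y \<in> topspace ?Z" "f (h y) = y"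
      using fh y by (auto simp: homeomorphic_maps_def continuous_map_def simp del: topspace_orbit_space)
    then show ?thesis using over by fastforce
  qed
  moreover have "homeomorphic_map M0 ?Z h"
    using fh homeomorphic_maps_map by blast
  ultimately show "isomorphic_covers M0 p0 ?Z ?r" unfolding isomorphic_covers_def by blast
qed

end
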